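(* Let $\mathfrak a\subset\mathfrak p$ be a maximal Abelian subalgebra and let $\mu_\tau\in\mathfrak a^*$ be the highest (restricted) weight of $\tau$ with respect to a positive Weyl chamber of $\mathfrak a$. Then the weights of $\tau$ with respect to $\mathfrak a$ are contained in the convex hull in $\mathfrak a^*$ of the Weyl group orbit $\mathcal W\cdot\mu_\tau$.
   Context: Setting: $G$ is a connected noncompact real semisimple Lie group with finite center, $K\subset G$ a maximal compact subgroup, $\mathfrak g=\mathfrak k\oplus\mathfrak p$ the corresponding Cartan decomposition, and $\tau:G\to \mathrm{SL}(V)$ an irreducible representation with finite kernel on a finite-dimensional complex vector space $V$. $h$ is a Hermitian scalar product on $V$ such that $\tau(G)$ is compatible with $\mathrm{SU}(V,h)^{\mathbb C}$, i.e. $\tau(K)\subset \mathrm{SU}(V,h)$, $\tau(\mathfrak p)\subset i\,\mathfrak{su}(V,h)$ and $\tau(G)=\tau(K)\exp(\tau(\mathfrak p))$. Weights: $\lambda\in\mathfrak a^*$ is a weight of $\tau$ if $V_\lambda=\{v\in V:\tau(H)v=\lambda(H)v\ \forall H\in\mathfrak a\}\neq0$. A positive Weyl chamber determines simple restricted roots $\Pi\subset\Delta(\mathfrak g,\mathfrak a)$, and the highest weight $\mu_\tau$ is the weight such that every weight has the form $\lambda=\mu_\tau-\sum_{\alpha\in\Pi}c_{\alpha,\lambda}\alpha$ with $c_{\alpha,\lambda}$ nonnegative integers. $\mathcal W=N_K(\mathfrak a)/K^{\mathfrak a}$ is the Weyl group, where $N_K(\mathfrak a)$ and $K^{\mathfrak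 a}$ are the normalizer and centralizer of $\mathfrak a$ in $K$. *)

theory Defs
  imports "HOL-Analysis.Analysis" "HOL-Algebra.Coset" "HOL-Library.Function_Algebras"
begin

section \<open>The real vector space of real-valued functions\<close>

text \<open>Pointwise scalar multiplication, so that \<open>convex hull\<close> is available for
  functionals; addition is the pointwise one of the library.\<close>

instantiation "fun" :: (type, real_vector) real_vector
begin

definition scaleR_fun :: "real \<Rightarrow> ('a \<Rightarrow> 'b) \<Rightarrow> 'a \<Rightarrow> 'b" where
  "scaleR_fun r f = (\<lambda>x. r *\<^sub>R f x)"

instance
  by standard (simp_all add: scaleR_fun_def fun_eq_iff scaleR_add_right scaleR_add_left)

end

lemma scaleR_fun_apply [simp]: "(r *\<^sub>R f) x = r *\<^sub>R f x"
  by (simp add: scaleR_fun_def)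


section \<open>Smooth manifolds and Lie groups\<close>

text \<open>\<open>Ck_on k S f\<close>: \<open>f\<close> is \<open>k\<close> times continuously differentiable on the open set \<open>S\<close>.
  The higher derivatives are expressed through iterated directional derivatives, because the
  type of an iterated total derivative would depend on \<open>k\<close>.\<close>

primrec Ck_on :: "nat \<Rightarrow> 'a::real_normed_vector set \<Rightarrow> ('a \<Rightarrow> 'b::real_normed_vector) \<Rightarrow> bool" where
  "Ck_on 0 S f \<longleftrightarrow> continuous_on S f"
| "Ck_on (Suc k) S f \<longleftrightarrow>
     (\<forall>x\<in>S. f differentiable (at x)) \<and>
     (\<forall>v. Ck_on k S (\<lambda>x. frechet_derivative f (at x) v))"

definition smooth_on :: "'a::real_normed_vector set \<Rightarrow> ('a \<Rightarrow> 'b::real_normed_vector) \<Rightarrow> bool" where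
  "smooth_on S f \<longleftrightarrow> (\<forall>k. Ck_on k S f)"

text \<open>A chart is a pair of its domain and its coordinate map; the map is only relevant on
  the domain.\<close>

type_synonym ('m, 'e) chart = "'m set \<times> ('m \<Rightarrow> 'e)"

definition smooth_manifold :: "'m topology \<Rightarrow> ('m, 'e::euclidean_space) chart set \<Rightarrow> bool" where
  "smooth_manifold T \<A> \<longleftrightarrow>
     Hausdorff_space T \<and> second_countable T \<and> (\<Union>(U, \<phi>)\<in>\<A>. U) = topspace T \<and>
     (\<forall>(U, \<phi>)\<in>\<A>. openin T U \<and> open (\<phi> ` U) \<and>
        homeomorphic_map (subtopology T U) (top_of_set (\<phi> ` U)) \<phi>) \<and>
     (\<forall>(U, \<phi>)\<in>\<A>. \<forall>(V, \<psi>)\<in>\<A>. smooth_on (\<phi> ` (U \<inter> V)) (\<psi> \<circ> inv_into U \<phi>))"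

text \<open>The openness condition expresses continuity.\<close>

definition smooth_map ::
  "('m, 'a::real_normed_vector) chart set \<Rightarrow> ('n, 'b::real_normed_vector) chart set
     \<Rightarrow> ('m \<Rightarrow> 'n) \<Rightarrow> bool" where
  "smooth_map \<A> \<B> f \<longleftrightarrow>
     f ` (\<Union>(U, \<phi>)\<in>\<A>. U) \<subseteq> (\<Union>(V, \<psi>)\<in>\<B>. V) \<and>
     (\<forall>(U, \<phi>)\<in>\<A>. \<forall>(V, \<psi>)\<in>\<B>.
        open (\<phi> ` (U \<inter> f -` V)) \<and>
        smooth_on (\<phi> ` (U \<inter> f -` V)) (\<psi> \<circ> f \<circ> inv_into U \<phi>))"

definition prod_atlas :: "('m, 'a) chart set \<Rightarrow> ('n, 'b) chart set \<Rightarrow> ('m \<times> 'n, 'a \<times> 'b) chart set" where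
  "prod_atlas \<A> \<B> = {(U \<times> V, map_prod \<phi> \<psi>) | U \<phi> V \<psi>. (U, \<phi>) \<in> \<A> \<and> (V, \<psi>) \<in> \<B>}"

definition vector_space_atlas :: "('a, 'a) chart set" where
  "vector_space_atlas = {(UNIV, id)}"

record ('g, 'e) lie_group_data = "'g monoid" +
  topo :: "'g topology"
  atlas :: "('g, 'e) chart set"

definition lie_group :: "('g, 'e::euclidean_space) lie_group_data \<Rightarrow> bool" where
  "lie_group G \<longleftrightarrow>
     group G \<and> topspace (topo G) = carrier G \<and> smooth_manifold (topo G) (atlas G) \<and>
     smooth_map (prod_atlas (atlas G) (atlas G)) (atlas G) (\<lambda>(x, y). x \<otimes>\<^bsub>G\<^esub> y) \<and>
     smooth_map (atlas G) (atlas G) (m_inv G)"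

definition group_center :: "('g, 'x) monoid_scheme \<Rightarrow> 'g set" where
  "group_center G = {z \<in> carrier G. \<forall>g\<in>carrier G. z \<otimes>\<^bsub>G\<^esub> g = g \<otimes>\<^bsub>G\<^esub> z}"

definition maximal_compact_subgroup :: "('g, 'e) lie_group_data \<Rightarrow> 'g set \<Rightarrow> bool" where
  "maximal_compact_subgroup G K \<longleftrightarrow>
     subgroup K G \<and> compactin (topo G) K \<and>
     (\<forall>K'. subgroup K' G \<and> compactin (topo G) K' \<and> K \<subseteq> K' \<longrightarrow> K' = K)"


section \<open>The Lie algebra\<close>

text \<open>We fix a chart around the identity and identify the tangent space at the identity with
  the model space \<open>'e\<close> by means of it.  The choice is arbitrary: another chart changes
  everything below by the linear isomorphism given by the derivative of the transition map.\<close>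

definition id_chart :: "('g, 'e) lie_group_data \<Rightarrow> ('g, 'e) chart" where
  "id_chart G = (SOME c. c \<in> atlas G \<and> \<one>\<^bsub>G\<^esub> \<in> fst c)"

abbreviation id_coord :: "('g, 'e) lie_group_data \<Rightarrow> 'g \<Rightarrow> 'e" where
  "id_coord G \<equiv> snd (id_chart G)"

abbreviation id_param :: "('g, 'e) lie_group_data \<Rightarrow> 'e \<Rightarrow> 'g" where
  "id_param G \<equiv> inv_into (fst (id_chart G)) (id_coord G)"

text \<open>Differential at the identity of a map from the group to a vector space.\<close>

definition diff_at_id ::
  "('g, 'e::euclidean_space) lie_group_data \<Rightarrow> ('g \<Rightarrow> 'w::real_normed_vector) \<Rightarrow> 'e \<Rightarrow> 'w" where
  "diff_at_id G f = frechet_derivative (f \<circ> id_param G) (at (id_coord G \<one>\<^bsub>G\<^esub>))"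

definition Ad :: "('g, 'e::euclidean_space) lie_group_data \<Rightarrow> 'g \<Rightarrow> 'e \<Rightarrow> 'e" where
  "Ad G g = diff_at_id G (\<lambda>x. id_coord G (g \<otimes>\<^bsub>G\<^esub> x \<otimes>\<^bsub>G\<^esub> inv\<^bsub>G\<^esub> g))"

text \<open>The bracket is given by \<open>ad\<close>, the differential of \<open>Ad\<close> at the identity.\<close>

definition lie_bracket :: "('g, 'e::euclidean_space) lie_group_data \<Rightarrow> 'e \<Rightarrow> 'e \<Rightarrow> 'e" where
  "lie_bracket G X Y = diff_at_id G (\<lambda>g. Ad G g Y) X"

definition operator_trace :: "('e::euclidean_space \<Rightarrow> 'e) \<Rightarrow> real" where
  "operator_trace f = (\<Sum>b\<in>Basis. f b \<bullet> b)"

definition killing_form :: "('g, 'e::euclidean_space) lie_group_data \<Rightarrow> 'e \<Rightarrow> 'e \<Rightarrow> real" where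
  "killing_form G X Y = operator_trace (lie_bracket G X \<circ> lie_bracket G Y)"

definition lie_ideal :: "('g, 'e::euclidean_space) lie_group_data \<Rightarrow> 'e set \<Rightarrow> bool" where
  "lie_ideal G I \<longleftrightarrow> subspace I \<and> (\<forall>X. \<forall>Y\<in>I. lie_bracket G X Y \<in> I)"

primrec derived_series :: "('g, 'e::euclidean_space) lie_group_data \<Rightarrow> 'e set \<Rightarrow> nat \<Rightarrow> 'e set" where
  "derived_series G I 0 = I"
| "derived_series G I (Suc n) =
     span {lie_bracket G X Y | X Y. X \<in> derived_series G I n \<and> Y \<in> derived_series G I n}"

definition solvable :: "('g, 'e::euclidean_space) lie_group_data \<Rightarrow> 'e set \<Rightarrow> bool" where
  "solvable G I \<longleftrightarrow> (\<exists>n. derived_series G I n = {0})"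

definition semisimple_lie_group :: "('g, 'e::euclidean_space) lie_group_data \<Rightarrow> bool" where
  "semisimple_lie_group G \<longleftrightarrow>
     lie_group G \<and> (\<forall>I. lie_ideal G I \<and> solvable G I \<longrightarrow> I = {0})"

text \<open>For a closed subgroup \<open>K\<close> this is the set of all \<open>X\<close> with \<open>exp (t X) \<in> K\<close> for all
  real \<open>t\<close>: the curve \<open>\<gamma>\<close> is \<open>t \<mapsto> exp (t X)\<close>, which is the one-parameter subgroup of \<open>G\<close>
  with velocity \<open>X\<close> at \<open>0\<close>.\<close>

definition lie_algebra_of_subgroup :: "('g, 'e::euclidean_space) lie_group_data \<Rightarrow> 'g set \<Rightarrow> 'e set" where
  "lie_algebra_of_subgroup G K =
     {X. \<exists>\<gamma> :: real \<Rightarrow> 'g.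
           smooth_map vector_space_atlas (atlas G) \<gamma> \<and>
           (\<forall>s t. \<gamma> (s + t) = \<gamma> s \<otimes>\<^bsub>G\<^esub> \<gamma> t) \<and>
           ((\<lambda>t. id_coord G (\<gamma> t)) has_vector_derivative X) (at 0) \<and>
           range \<gamma> \<subseteq> K}"

definition cartan_decomposition ::
  "('g, 'e::euclidean_space) lie_group_data \<Rightarrow> 'e set \<Rightarrow> 'e set \<Rightarrow> bool" where
  "cartan_decomposition G \<kk> \<pp> \<longleftrightarrow>
     subspace \<kk> \<and> subspace \<pp> \<and>
     \<kk> \<inter> \<pp> = {0} \<and> {X + Y | X Y. X \<in> \<kk> \<and> Y \<in> \<pp>} = UNIV \<and>
     (\<forall>X\<in>\<kk>. \<forall>Y\<in>\<kk>. lie_bracket G X Y \<in> \<kk>) \<and>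
     (\<forall>X\<in>\<kk>. \<forall>Y\<in>\<pp>. lie_bracket G X Y \<in> \<pp>) \<and>
     (\<forall>X\<in>\<pp>. \<forall>Y\<in>\<pp>. lie_bracket G X Y \<in> \<kk>) \<and>
     (\<forall>X\<in>\<kk>. X \<noteq> 0 \<longrightarrow> killing_form G X X < 0) \<and>
     (\<forall>X\<in>\<pp>. X \<noteq> 0 \<longrightarrow> killing_form G X X > 0)"

definition abelian_subalgebra_in ::
  "('g, 'e::euclidean_space) lie_group_data \<Rightarrow> 'e set \<Rightarrow> 'e set \<Rightarrow> bool" where
  "abelian_subalgebra_in G \<pp> \<aa> \<longleftrightarrow>
     subspace \<aa> \<and> \<aa> \<subseteq> \<pp> \<and> (\<forall>X\<in>\<aa>. \<forall>Y\<in>\<aa>. lie_bracket G X Y = 0)"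

definition maximal_abelian_subalgebra_in ::
  "('g, 'e::euclidean_space) lie_group_data \<Rightarrow> 'e set \<Rightarrow> 'e set \<Rightarrow> bool" where
  "maximal_abelian_subalgebra_in G \<pp> \<aa> \<longleftrightarrow>
     abelian_subalgebra_in G \<pp> \<aa> \<and>
     (\<forall>\<bb>. abelian_subalgebra_in G \<pp> \<bb> \<and> \<aa> \<subseteq> \<bb> \<longrightarrow> \<bb> = \<aa>)"


section \<open>Representations\<close>

definition SL :: "(complex^'n^'n) monoid" where
  "SL = \<lparr>carrier = {A. det A = 1}, monoid.mult = (**), one = mat 1\<rparr>"

definition smooth_representation ::
  "('g, 'e::euclidean_space) lie_group_data \<Rightarrow> ('g \<Rightarrow> complex^'n^'n) \<Rightarrow> bool" where
  "smooth_representation G \<tau> \<longleftrightarrow>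
     \<tau> \<in> hom G SL \<and> smooth_map (atlas G) vector_space_atlas \<tau>"

definition irreducible_rep :: "('g, 'x) monoid_scheme \<Rightarrow> ('g \<Rightarrow> complex^'n^'n) \<Rightarrow> bool" where
  "irreducible_rep G \<tau> \<longleftrightarrow>
     (\<forall>W. vec.subspace W \<and> (\<forall>g\<in>carrier G. \<forall>w\<in>W. \<tau> g *v w \<in> W) \<longrightarrow> W = {0} \<or> W = UNIV)"

definition hermitian_scalar_product :: "(complex^'n \<Rightarrow> complex^'n \<Rightarrow> complex) \<Rightarrow> bool" where
  "hermitian_scalar_product h \<longleftrightarrow>
     (\<forall>u v w. h (u + v) w = h u w + h v w) \<and>
     (\<forall>c v w. h (c *s v) w = c * h v w) \<and>
     (\<forall>v w. h w v = cnj (h v w)) \<and>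
     (\<forall>v. v \<noteq> 0 \<longrightarrow> Re (h v v) > 0)"

definition SU :: "(complex^'n \<Rightarrow> complex^'n \<Rightarrow> complex) \<Rightarrow> (complex^'n^'n) set" where
  "SU h = {A. det A = 1 \<and> (\<forall>v w. h (A *v v) (A *v w) = h v w)}"

definition su :: "(complex^'n \<Rightarrow> complex^'n \<Rightarrow> complex) \<Rightarrow> (complex^'n^'n) set" where
  "su h = {A. trace A = 0 \<and> (\<forall>v w. h (A *v v) w + h v (A *v w) = 0)}"

definition i_su :: "(complex^'n \<Rightarrow> complex^'n \<Rightarrow> complex) \<Rightarrow> (complex^'n^'n) set" where
  "i_su h = {\<chi> j k. \<i> * A $ j $ k | A. A \<in> su h}"

definition matrix_exp :: "complex^'n^'n \<Rightarrow> complex^'n^'n" where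
  "matrix_exp A = (\<Sum>m. (1 / fact m) *\<^sub>R (((**) A) ^^ m) (mat 1))"

definition compatible_rep ::
  "('g, 'e::euclidean_space) lie_group_data \<Rightarrow> 'g set \<Rightarrow> 'e set \<Rightarrow>
   (complex^'n \<Rightarrow> complex^'n \<Rightarrow> complex) \<Rightarrow> ('g \<Rightarrow> complex^'n^'n) \<Rightarrow> bool" where
  "compatible_rep G K \<pp> h \<tau> \<longleftrightarrow>
     \<tau> ` K \<subseteq> SU h \<and>
     diff_at_id G \<tau> ` \<pp> \<subseteq> i_su h \<and>
     \<tau> ` carrier G = {\<tau> k ** matrix_exp (diff_at_id G \<tau> X) | k X. k \<in> K \<and> X \<in> \<pp>}"


section \<open>Weights, restricted roots and the Weyl group\<close>

text \<open>Functionals on the subspace \<open>\<aa>\<close> are represented uniquely by functions on the whole space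
  that vanish off \<open>\<aa>\<close>.  They form a linear subspace of the function space, hence sums, multiples
  and convex hulls formed there are those of the dual space.\<close>

definition dual_space :: "'e::real_vector set \<Rightarrow> ('e \<Rightarrow> real) set" where
  "dual_space \<aa> =
     {\<nu>. (\<forall>x\<in>\<aa>. \<forall>y\<in>\<aa>. \<nu> (x + y) = \<nu> x + \<nu> y) \<and> (\<forall>c. \<forall>x\<in>\<aa>. \<nu> (c *\<^sub>R x) = c * \<nu> x) \<and>
         (\<forall>x. x \<notin> \<aa> \<longrightarrow> \<nu> x = 0)}"

definition weight_space ::
  "('g, 'e::euclidean_space) lie_group_data \<Rightarrow> 'e set \<Rightarrow> ('g \<Rightarrow> complex^'n^'n) \<Rightarrow>
   ('e \<Rightarrow> real) \<Rightarrow> (complex^'n) set" where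
  "weight_space G \<aa> \<tau> \<nu> = {v. \<forall>H\<in>\<aa>. diff_at_id G \<tau> H *v v = complex_of_real (\<nu> H) *s v}"

definition weights ::
  "('g, 'e::euclidean_space) lie_group_data \<Rightarrow> 'e set \<Rightarrow> ('g \<Rightarrow> complex^'n^'n) \<Rightarrow>
   ('e \<Rightarrow> real) set" where
  "weights G \<aa> \<tau> = {\<nu> \<in> dual_space \<aa>. weight_space G \<aa> \<tau> \<nu> \<noteq> {0}}"

definition restricted_root_space ::
  "('g, 'e::euclidean_space) lie_group_data \<Rightarrow> 'e set \<Rightarrow> ('e \<Rightarrow> real) \<Rightarrow> 'e set" where
  "restricted_root_space G \<aa> \<alpha> = {X. \<forall>H\<in>\<aa>. lie_bracket G H X = \<alpha> H *\<^sub>R X}"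

definition restricted_roots ::
  "('g, 'e::euclidean_space) lie_group_data \<Rightarrow> 'e set \<Rightarrow> ('e \<Rightarrow> real) set" where
  "restricted_roots G \<aa> = {\<alpha> \<in> dual_space \<aa>. \<alpha> \<noteq> 0 \<and> restricted_root_space G \<aa> \<alpha> \<noteq> {0}}"

definition weyl_chamber ::
  "('g, 'e::euclidean_space) lie_group_data \<Rightarrow> 'e set \<Rightarrow> 'e set \<Rightarrow> bool" where
  "weyl_chamber G \<aa> C \<longleftrightarrow>
     C \<in> components {H \<in> \<aa>. \<forall>\<alpha>\<in>restricted_roots G \<aa>. \<alpha> H \<noteq> 0}"

definition positive_roots ::
  "('g, 'e::euclidean_space) lie_group_data \<Rightarrow> 'e set \<Rightarrow> 'e set \<Rightarrow> ('e \<Rightarrow> real) set" where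
  "positive_roots G \<aa> C = {\<alpha> \<in> restricted_roots G \<aa>. \<forall>H\<in>C. \<alpha> H > 0}"

definition simple_roots ::
  "('g, 'e::euclidean_space) lie_group_data \<Rightarrow> 'e set \<Rightarrow> 'e set \<Rightarrow> ('e \<Rightarrow> real) set" where
  "simple_roots G \<aa> C =
     {\<alpha> \<in> positive_roots G \<aa> C.
        \<not> (\<exists>\<beta>\<in>positive_roots G \<aa> C. \<exists>\<gamma>\<in>positive_roots G \<aa> C. \<alpha> = \<beta> + \<gamma>)}"

definition highest_weight ::
  "('g, 'e::euclidean_space) lie_group_data \<Rightarrow> 'e set \<Rightarrow> 'e set \<Rightarrow> ('g \<Rightarrow> complex^'n^'n) \<Rightarrow>
   ('e \<Rightarrow> real) \<Rightarrow> bool" where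
  "highest_weight G \<aa> C \<tau> \<mu> \<longleftrightarrow>
     \<mu> \<in> weights G \<aa> \<tau> \<and>
     (\<forall>\<nu>\<in>weights G \<aa> \<tau>. \<exists>c :: ('e \<Rightarrow> real) \<Rightarrow> nat.
        \<nu> = \<mu> - (\<Sum>\<alpha>\<in>simple_roots G \<aa> C. real (c \<alpha>) *\<^sub>R \<alpha>))"

definition normalizer_in ::
  "('g, 'e::euclidean_space) lie_group_data \<Rightarrow> 'g set \<Rightarrow> 'e set \<Rightarrow> 'g set" where
  "normalizer_in G K \<aa> = {k \<in> K. Ad G k ` \<aa> = \<aa>}"

definition centralizer_in ::
  "('g, 'e::euclidean_space) lie_group_data \<Rightarrow> 'g set \<Rightarrow> 'e set \<Rightarrow> 'g set" where
  "centralizer_in G K \<aa> = {k \<in> K. \<forall>H\<in>\<aa>. Ad G k H = H}"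

definition weyl_group ::
  "('g, 'e::euclidean_space) lie_group_data \<Rightarrow> 'g set \<Rightarrow> 'e set \<Rightarrow> 'g set monoid" where
  "weyl_group G K \<aa> = (G\<lparr>carrier := normalizer_in G K \<aa>\<rparr>) Mod (centralizer_in G K \<aa>)"

text \<open>A coset acts on the dual of \<open>\<aa>\<close> by the contragredient action of any representative.\<close>

definition weyl_action ::
  "('g, 'e::euclidean_space) lie_group_data \<Rightarrow> 'e set \<Rightarrow> 'g set \<Rightarrow> ('e \<Rightarrow> real) \<Rightarrow> 'e \<Rightarrow> real" where
  "weyl_action G \<aa> w \<nu> =
     (\<lambda>H. if H \<in> \<aa> then \<nu> (Ad G (inv\<^bsub>G\<^esub> (SOME k. k \<in> w)) H) else 0)"

definition weyl_orbit ::
  "('g, 'e::euclidean_space) lie_group_data \<Rightarrow> 'g set \<Rightarrow> 'e set \<Rightarrow> ('e \<Rightarrow> real) \<Rightarrow> ('e \<Rightarrow> real) set" where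
  "weyl_orbit G K \<aa> \<nu> = {weyl_action G \<aa> w \<nu> | w. w \<in> carrier (weyl_group G K \<aa>)}"

end

theory Submission
  imports Defs
begin

text \<open>Why the theorem holds.  A functional outside the convex hull of the finite Weyl orbit of \<open>\<mu>\<close> is
  separated from it by some \<open>H \<in> \<aa>\<close>, and \<open>H\<close> may be moved a little so that no restricted root
  vanishes at it.  So it suffices that for every weight \<open>\<nu>\<close> and every such regular \<open>H\<close> some orbit point
  is at least \<open>\<nu>(H)\<close> at \<open>H\<close>.  Let \<open>k\<close> in the normaliser of \<open>\<aa>\<close> in \<open>K\<close> carry \<open>H\<close> into the closed Weyl
  chamber.  By \<open>weights_invariant\<close>, \<open>k\<cdot>\<nu>\<close> is a weight, so it equals \<open>\<mu>\<close> minus nonnegative multiples of simple roots, which are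
  nonnegative at \<open>Ad k H\<close>, hence
  \<open>\<nu>(H) = (k\<cdot>\<nu>)(Ad k H) \<le> \<mu>(Ad k H) = (k\<inverse>\<cdot>\<mu>)(H)\<close>
  (\<open>orbit_bounds_weight_at_regular\<close>).

  The element \<open>k\<close> is found without root reflections (\<open>regular_conjugate_to_chamber\<close>).  Fix \<open>Y\<close> in the
  chamber and maximise \<open>l \<mapsto> \<langle>Ad l H, Y\<rangle>\<close> over the compact group \<open>K\<close>.  The first derivative at a
  maximiser \<open>k\<close> shows that \<open>Ad k H\<close> commutes with \<open>Y\<close>.  The centraliser in \<open>\<pp>\<close> of a regular element is
  \<open>\<aa>\<close> (\<open>centralizer_of_regular\<close>), so \<open>Ad k H \<in> \<aa>\<close>, and since \<open>H\<close> is regular as well, \<open>k\<close>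
  normalises \<open>\<aa>\<close>.  The second derivative in the direction of the \<open>\<kk>\<close>-part of a root vector shows that
  \<open>\<alpha>(Ad k H)\<close> and \<open>\<alpha>(Y)\<close> do not have opposite signs, for every restricted root \<open>\<alpha>\<close>.

  All computations in the Lie algebra are carried out on matrices.  Differentiating \<open>\<tau>\<close> gives
  \<open>d\<tau>(Ad g X) = \<tau>(g) d\<tau>(X) \<tau>(g)\<inverse>\<close> and \<open>d\<tau>[X, Y] = [d\<tau> X, d\<tau> Y]\<close>, and \<open>d\<tau>\<close> is injective
  (\<open>D_eq_0\<close>): on \<open>\<kk>\<close> because the kernel of \<open>\<tau>\<close> is finite, on \<open>\<pp>\<close> because the Killing form is
  positive there.  In an orthonormal frame \<open>\<kk>\<close> acts by skew-Hermitian and \<open>\<pp>\<close> by Hermitian matrices,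
  so the real inner product of matrices pulls back to an inner product on the Lie algebra for which
  \<open>ad X\<close> is skew for \<open>X \<in> \<kk>\<close> and symmetric for \<open>X \<in> \<pp>\<close>.\<close>

section \<open>Twice differentiable maps\<close>

text \<open>Two derivatives are exactly what the bracket costs: one for \<open>Ad g\<close>, one more for its
  differential in \<open>g\<close>.\<close>

definition twice_differentiable_on ::
  "'a::euclidean_space set \<Rightarrow> ('a \<Rightarrow> 'b::real_normed_vector) \<Rightarrow> bool" where
  "twice_differentiable_on N f \<longleftrightarrow> open N \<and> (\<forall>x\<in>N. f differentiable (at x)) \<and>
     (\<forall>v. \<forall>x\<in>N. (\<lambda>y. frechet_derivative f (at y) v) differentiable (at x))"

lemma differentiable_cong_open:
  assumes "f differentiable (at x)" "open N" "x \<in> N" "\<And>y. y \<in> N \<Longrightarrow> f y = g y"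
  shows "g differentiable (at x)"
  using assms has_derivative_transform_within_open unfolding differentiable_def by blast

lemma twice_differentiable_on_cong:
  assumes f: "twice_differentiable_on N f" and eq: "\<And>y. y \<in> N \<Longrightarrow> f y = g y"
  shows "twice_differentiable_on N g"
proof -
  have N: "open N" using f by (simp add: twice_differentiable_on_def)
  have "frechet_derivative f (at y) v = frechet_derivative g (at y) v" if "y \<in> N" for y v
    using f that eq N by (metis frechet_derivative_transform_within_open twice_differentiable_on_def)
  then show ?thesis
    using f eq N unfolding twice_differentiable_on_def
    by (meson differentiable_cong_open)
qed

lemma twice_differentiable_on_subset:
  "twice_differentiable_on N f \<Longrightarrow> open M \<Longrightarrow> M \<subseteq> N \<Longrightarrow> twice_differentiable_on M f"
  unfolding twice_differentiable_on_def by blast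

lemma twice_differentiable_on_continuous:
  "twice_differentiable_on N f \<Longrightarrow> continuous_on N f"
  unfolding twice_differentiable_on_def
  by (meson continuous_at_imp_continuous_on differentiable_imp_continuous_within)

lemma twice_differentiable_on_const: "open N \<Longrightarrow> twice_differentiable_on N (\<lambda>x. c)"
  by (simp add: twice_differentiable_on_def)

lemma twice_differentiable_on_bounded_linear:
  assumes "bounded_linear f" "open N"
  shows "twice_differentiable_on N f"
proof -
  have "(f has_derivative f) (at x)" for x
    using assms(1) by (rule bounded_linear_imp_has_derivative)
  then have "f differentiable (at x)" "frechet_derivative f (at x) = f" for x
    using differentiable_def frechet_derivative_at by (blast, metis)
  then show ?thesis
    using assms(2) by (simp add: twice_differentiable_on_def)
qed

lemma has_derivative_frechet:
  "twice_differentiable_on N f \<Longrightarrow> x \<in> N \<Longrightarrow>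
    (f has_derivative frechet_derivative f (at x)) (at x)"
  by (simp add: twice_differentiable_on_def frechet_derivative_works)

lemma twice_differentiable_on_Pair:
  assumes f: "twice_differentiable_on N f" and g: "twice_differentiable_on N g"
  shows "twice_differentiable_on N (\<lambda>x. (f x, g x))"
proof -
  have N: "open N" using f by (simp add: twice_differentiable_on_def)
  have d: "((\<lambda>x. (f x, g x)) has_derivative
      (\<lambda>v. (frechet_derivative f (at x) v, frechet_derivative g (at x) v))) (at x)"
    if "x \<in> N" for x
    using has_derivative_frechet[OF f that] has_derivative_frechet[OF g that]
    by (rule has_derivative_Pair)
  have e: "frechet_derivative (\<lambda>x. (f x, g x)) (at x) v =
      (frechet_derivative f (at x) v, frechet_derivative g (at x) v)" if "x \<in> N" for x v
    using frechet_derivative_at[OF d[OF that]] by metis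
  have "(\<lambda>y. frechet_derivative (\<lambda>x. (f x, g x)) (at y) v) differentiable (at x)"
    if x: "x \<in> N" for x v
  proof (rule differentiable_cong_open[OF _ N x])
    have "(\<lambda>y. frechet_derivative f (at y) v) differentiable (at x)"
      "(\<lambda>y. frechet_derivative g (at y) v) differentiable (at x)"
      using f g x by (auto simp: twice_differentiable_on_def)
    then show "(\<lambda>y. (frechet_derivative f (at y) v, frechet_derivative g (at y) v))
        differentiable (at x)"
      unfolding differentiable_def using has_derivative_Pair by blast
  qed (use e in simp)
  then show ?thesis
    using N d unfolding twice_differentiable_on_def differentiable_def by blast
qed

text \<open>The chain rule gives \<open>D (g \<circ> f) x v = D g (f x) (D f x v)\<close>.  Here the vector to which
  \<open>D g (f x)\<close> is applied moves with \<open>x\<close>; expanding it in a basis reduces the claim to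
  derivatives in fixed directions.\<close>

lemma twice_differentiable_on_compose:
  fixes f :: "'a::euclidean_space \<Rightarrow> 'b::euclidean_space"
    and g :: "'b \<Rightarrow> 'c::real_normed_vector"
  assumes f: "twice_differentiable_on N f" and g: "twice_differentiable_on M g"
    and fN: "f ` N \<subseteq> M"
  shows "twice_differentiable_on N (g \<circ> f)"
proof -
  have N: "open N" using f by (simp add: twice_differentiable_on_def)
  have d: "((g \<circ> f) has_derivative
      frechet_derivative g (at (f x)) \<circ> frechet_derivative f (at x)) (at x)"
    if "x \<in> N" for x
    using has_derivative_frechet[OF f that] has_derivative_frechet[OF g, of "f x"] fN that
    by (intro diff_chain_at) auto
  have e: "frechet_derivative (g \<circ> f) (at x) v =
      (\<Sum>b\<in>Basis. (frechet_derivative f (at x) v \<bullet> b) *\<^sub>R frechet_derivative g (at (f x)) b)"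
    if x: "x \<in> N" for x v
  proof -
    have "f x \<in> M" using fN x by blast
    then have lin: "linear (frechet_derivative g (at (f x)))"
      using g by (simp add: twice_differentiable_on_def linear_frechet_derivative)
    have "frechet_derivative (g \<circ> f) (at x) v =
        frechet_derivative g (at (f x)) (frechet_derivative f (at x) v)"
      using frechet_derivative_at[OF d[OF x]] by (metis comp_apply)
    also have "\<dots> = frechet_derivative g (at (f x))
        (\<Sum>b\<in>Basis. (frechet_derivative f (at x) v \<bullet> b) *\<^sub>R b)"
      by (simp add: euclidean_representation)
    also have "\<dots> =
        (\<Sum>b\<in>Basis. (frechet_derivative f (at x) v \<bullet> b) *\<^sub>R frechet_derivative g (at (f x)) b)"
      by (simp add: linear_sum[OF lin] linear_cmul[OF lin])
    finally show ?thesis .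
  qed
  have "(\<lambda>y. frechet_derivative (g \<circ> f) (at y) v) differentiable (at x)"
    if x: "x \<in> N" for x v
  proof (rule differentiable_cong_open[OF _ N x])
    have fx: "f x \<in> M" using fN x by blast
    have 1: "(\<lambda>y. frechet_derivative f (at y) v) differentiable (at x)" "f differentiable (at x)"
      using f x by (auto simp: twice_differentiable_on_def)
    have 2: "(\<lambda>y. frechet_derivative g (at y) b) differentiable (at (f x))" for b
      using g fx by (auto simp: twice_differentiable_on_def)
    have 3: "(\<lambda>y. frechet_derivative g (at (f y)) b) differentiable (at x)" for b
      using differentiable_chain_at[OF 1(2) 2[of b]] by (simp add: comp_def)
    show "(\<lambda>y. \<Sum>b\<in>Basis. (frechet_derivative f (at y) v \<bullet> b) *\<^sub>R
        frechet_derivative g (at (f y)) b) differentiable (at x)"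
      using 1(1) 3 by (intro differentiable_sum differentiable_scaleR differentiable_inner) auto
  qed (use e in simp)
  then show ?thesis
    using N d unfolding twice_differentiable_on_def differentiable_def by blast
qed

lemma smooth_on_imp_twice_differentiable:
  assumes "smooth_on S f" "open S"
  shows "twice_differentiable_on S f"
proof -
  have "Ck_on (Suc (Suc 0)) S f" using assms by (simp add: smooth_on_def del: Ck_on.simps)
  then show ?thesis using assms(2) by (auto simp: twice_differentiable_on_def)
qed

text \<open>A smooth map may be composed with a map into its source that is only twice
  differentiable; every chart of the target around the image point can be used.\<close>

lemma smooth_map_compose_twice_differentiable:
  fixes \<A> :: "('m, 'a::euclidean_space) chart set" and \<B> :: "('n, 'b::real_normed_vector) chart set"
    and f :: "'c::euclidean_space \<Rightarrow> 'm"
  assumes F: "smooth_map \<A> \<B> F" and U: "(U, \<phi>) \<in> \<A>" "inj_on \<phi> U" and V: "(V, \<psi>) \<in> \<B>"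
    and f: "twice_differentiable_on N (\<phi> \<circ> f)" "f ` N \<subseteq> U" and x: "x \<in> N" "F (f x) \<in> V"
  obtains M where "open M" "x \<in> M" "M \<subseteq> N" "\<And>y. y \<in> M \<Longrightarrow> F (f y) \<in> V"
    "twice_differentiable_on M (\<lambda>y. \<psi> (F (f y)))"
proof -
  define S where "S = \<phi> ` (U \<inter> F -` V)"
  have S: "open S" "smooth_on S (\<psi> \<circ> F \<circ> inv_into U \<phi>)"
    using bspec[OF bspec[OF conjunct2[OF F[unfolded smooth_map_def]] U(1), unfolded prod.case] V,
      unfolded prod.case] unfolding S_def by simp_all
  have N: "open N" using f(1) by (simp add: twice_differentiable_on_def)
  define M where "M = N \<inter> (\<phi> \<circ> f) -` S"
  have M: "open M"
    unfolding M_def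
    using continuous_open_preimage[OF twice_differentiable_on_continuous[OF f(1)] N S(1)] .
  have mem: "F (f y) \<in> V" if "y \<in> M" for y
    using that f(2) U(2) unfolding M_def S_def inj_on_def by auto
  have "twice_differentiable_on M ((\<psi> \<circ> F \<circ> inv_into U \<phi>) \<circ> (\<phi> \<circ> f))"
    using twice_differentiable_on_compose[OF twice_differentiable_on_subset[OF f(1) M]
        smooth_on_imp_twice_differentiable[OF S(2,1)]]
    unfolding M_def by blast
  then have "twice_differentiable_on M (\<lambda>y. \<psi> (F (f y)))"
    by (rule twice_differentiable_on_cong)
      (use f(2) U(2) in \<open>auto simp: M_def image_subset_iff inv_into_f_f\<close>)
  moreover have "x \<in> M" using x f(2) unfolding M_def S_def by auto
  ultimately show ?thesis using that M mem unfolding M_def by blast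
qed

section \<open>Lie groups in charts\<close>

text \<open>One chart around \<open>f x\<close> is enough in the definition: the lemmas on products and inverses below
  pass to an arbitrary chart around the value, because the group operations are smooth in all
  charts.\<close>

definition twice_differentiable_into ::
  "('g, 'e::euclidean_space) lie_group_data \<Rightarrow> ('c::euclidean_space \<Rightarrow> 'g) \<Rightarrow> 'c \<Rightarrow> bool" where
  "twice_differentiable_into G f x \<longleftrightarrow>
     (\<exists>U \<phi> N. (U, \<phi>) \<in> atlas G \<and> x \<in> N \<and> f ` N \<subseteq> U \<and> twice_differentiable_on N (\<phi> \<circ> f))"

lemma lie_group_chart:
  assumes "lie_group G" "(U, \<phi>) \<in> atlas G"
  shows "U \<subseteq> carrier G" "openin (topo G) U" "open (\<phi> ` U)" "inj_on \<phi> U"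
    "homeomorphic_map (subtopology (topo G) U) (top_of_set (\<phi> ` U)) \<phi>"
proof -
  have "\<forall>(U, \<phi>)\<in>atlas G. openin (topo G) U \<and> open (\<phi> ` U) \<and>
        homeomorphic_map (subtopology (topo G) U) (top_of_set (\<phi> ` U)) \<phi>"
    and T: "topspace (topo G) = carrier G"
    using assms(1) by (auto simp: lie_group_def smooth_manifold_def)
  then show *: "openin (topo G) U" "open (\<phi> ` U)"
    and h: "homeomorphic_map (subtopology (topo G) U) (top_of_set (\<phi> ` U)) \<phi>"
    using assms(2) by auto
  show s: "U \<subseteq> carrier G" using openin_subset[OF *(1)] T by simp
  show "inj_on \<phi> U"
    using homeomorphic_imp_injective_map[OF h] s T by (simp add: inf_absorb2)
qed

lemma lie_group_obtain_chart:
  assumes "lie_group G" "g \<in> carrier G"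
  obtains U \<phi> where "(U, \<phi>) \<in> atlas G" "g \<in> U"
proof -
  have "(\<Union>(U, \<phi>)\<in>atlas G. U) = carrier G"
    using assms(1) by (simp add: lie_group_def smooth_manifold_def)
  then show ?thesis using assms(2) that by auto
qed

lemma lie_group_group: "lie_group G \<Longrightarrow> group G"
  by (simp add: lie_group_def)

lemma id_chart:
  assumes "lie_group G"
  shows "id_chart G \<in> atlas G" "\<one>\<^bsub>G\<^esub> \<in> fst (id_chart G)"
proof -
  interpret group G using assms by (rule lie_group_group)
  obtain U \<phi> where "(U, \<phi>) \<in> atlas G" "\<one>\<^bsub>G\<^esub> \<in> U"
    using lie_group_obtain_chart[OF assms one_closed] .
  then have "\<exists>c. c \<in> atlas G \<and> \<one>\<^bsub>G\<^esub> \<in> fst c" by force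
  then show "id_chart G \<in> atlas G" "\<one>\<^bsub>G\<^esub> \<in> fst (id_chart G)"
    unfolding id_chart_def by (metis (mono_tags, lifting) someI_ex)+
qed

lemma id_chart_props:
  assumes "lie_group G"
  shows "(fst (id_chart G), id_coord G) \<in> atlas G"
    and "open (id_coord G ` fst (id_chart G))"
    and "inj_on (id_coord G) (fst (id_chart G))"
    and "fst (id_chart G) \<subseteq> carrier G"
  using id_chart[OF assms] lie_group_chart[OF assms, of "fst (id_chart G)" "id_coord G"] by auto

lemma twice_differentiable_into_in_chart:
  assumes "twice_differentiable_into G f x" "lie_group G" "smooth_map (atlas G) \<B> F"
    "(V, \<psi>) \<in> \<B>" "F (f x) \<in> V"
  obtains M where "x \<in> M" "\<And>y. y \<in> M \<Longrightarrow> F (f y) \<in> V"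
    "twice_differentiable_on M (\<lambda>y. \<psi> (F (f y)))"
proof -
  obtain U \<phi> N where "(U, \<phi>) \<in> atlas G" "x \<in> N" "f ` N \<subseteq> U" "twice_differentiable_on N (\<phi> \<circ> f)"
    using assms(1) unfolding twice_differentiable_into_def by blast
  then show ?thesis
    using smooth_map_compose_twice_differentiable[OF assms(3) _ _ assms(4), of U \<phi> N f x]
      lie_group_chart(4)[OF assms(2)] assms(5) that by metis
qed

lemma twice_differentiable_into_mult_in_chart:
  fixes G :: "('g, 'e::euclidean_space) lie_group_data"
  assumes G: "lie_group G" and f: "twice_differentiable_into G f x"
    and g: "twice_differentiable_into G g x"
    and W: "(W, \<xi>) \<in> atlas G" "f x \<otimes>\<^bsub>G\<^esub> g x \<in> W"
  obtains M where "x \<in> M" "\<And>y. y \<in> M \<Longrightarrow> f y \<otimes>\<^bsub>G\<^esub> g y \<in> W"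
    "twice_differentiable_on M (\<lambda>y. \<xi> (f y \<otimes>\<^bsub>G\<^esub> g y))"
proof -
  obtain U \<phi> N where U: "(U, \<phi>) \<in> atlas G" "x \<in> N" "f ` N \<subseteq> U" "twice_differentiable_on N (\<phi> \<circ> f)"
    using f unfolding twice_differentiable_into_def by blast
  obtain V \<psi> N' where V: "(V, \<psi>) \<in> atlas G" "x \<in> N'" "g ` N' \<subseteq> V" "twice_differentiable_on N' (\<psi> \<circ> g)"
    using g unfolding twice_differentiable_into_def by blast
  have N: "open (N \<inter> N')" using U(4) V(4) by (auto simp: twice_differentiable_on_def)
  have "smooth_map (prod_atlas (atlas G) (atlas G)) (atlas G) (\<lambda>(x, y). x \<otimes>\<^bsub>G\<^esub> y)"
    using G by (simp add: lie_group_def)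
  moreover have "(U \<times> V, map_prod \<phi> \<psi>) \<in> prod_atlas (atlas G) (atlas G)"
    using U V unfolding prod_atlas_def by blast
  moreover have "inj_on (map_prod \<phi> \<psi>) (U \<times> V)"
    using lie_group_chart(4)[OF G U(1)] lie_group_chart(4)[OF G V(1)] by (rule map_prod_inj_on)
  moreover have "twice_differentiable_on (N \<inter> N') (map_prod \<phi> \<psi> \<circ> (\<lambda>y. (f y, g y)))"
    using twice_differentiable_on_Pair[OF twice_differentiable_on_subset[OF U(4) N]
       twice_differentiable_on_subset[OF V(4) N]] by (simp add: comp_def)
  moreover have "(\<lambda>y. (f y, g y)) ` (N \<inter> N') \<subseteq> U \<times> V" using U V by auto
  ultimately obtain M where "open M" "x \<in> M" "M \<subseteq> N \<inter> N'"
    "\<And>y. y \<in> M \<Longrightarrow> (\<lambda>(x, y). x \<otimes>\<^bsub>G\<^esub> y) (f y, g y) \<in> W"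
    "twice_differentiable_on M (\<lambda>y. \<xi> ((\<lambda>(x, y). x \<otimes>\<^bsub>G\<^esub> y) (f y, g y)))"
    by (rule smooth_map_compose_twice_differentiable[OF _ _ _ W(1), where x = x])
      (use U(2) V(2) W(2) in auto)
  then show ?thesis using that by simp
qed

lemma twice_differentiable_intoI:
  assumes "(U, \<phi>) \<in> atlas G" "x \<in> N" "\<And>y. y \<in> N \<Longrightarrow> f y \<in> U" "twice_differentiable_on N (\<lambda>y. \<phi> (f y))"
  shows "twice_differentiable_into G f x"
  using assms unfolding twice_differentiable_into_def comp_def by blast

lemma twice_differentiable_into_mult:
  fixes G :: "('g, 'e::euclidean_space) lie_group_data"
  assumes G: "lie_group G" and f: "twice_differentiable_into G f x"
    and g: "twice_differentiable_into G g x"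
  shows "twice_differentiable_into G (\<lambda>y. f y \<otimes>\<^bsub>G\<^esub> g y) x"
proof -
  interpret group G using G by (rule lie_group_group)
  have "f x \<in> carrier G" "g x \<in> carrier G"
    using f g lie_group_chart(1)[OF G] unfolding twice_differentiable_into_def
    by (metis image_subset_iff subset_iff)+
  then have "f x \<otimes>\<^bsub>G\<^esub> g x \<in> carrier G" by simp
  then obtain W \<xi> where W: "(W, \<xi>) \<in> atlas G" "f x \<otimes>\<^bsub>G\<^esub> g x \<in> W"
    by (rule lie_group_obtain_chart[OF G])
  obtain M where M: "x \<in> M" "\<And>y. y \<in> M \<Longrightarrow> f y \<otimes>\<^bsub>G\<^esub> g y \<in> W"
    "twice_differentiable_on M (\<lambda>y. \<xi> (f y \<otimes>\<^bsub>G\<^esub> g y))"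
    by (rule twice_differentiable_into_mult_in_chart[OF G f g W]) (blast intro: that)
  show ?thesis using twice_differentiable_intoI[OF W(1) M] .
qed

lemma twice_differentiable_into_inv:
  assumes G: "lie_group G" and f: "twice_differentiable_into G f x"
  shows "twice_differentiable_into G (\<lambda>y. inv\<^bsub>G\<^esub> f y) x"
proof -
  interpret group G using G by (rule lie_group_group)
  have "f x \<in> carrier G"
    using f lie_group_chart(1)[OF G] unfolding twice_differentiable_into_def
    by (metis image_subset_iff subset_iff)
  then have "inv\<^bsub>G\<^esub> f x \<in> carrier G" by simp
  then obtain W \<xi> where W: "(W, \<xi>) \<in> atlas G" "inv\<^bsub>G\<^esub> f x \<in> W"
    by (rule lie_group_obtain_chart[OF G])
  have "smooth_map (atlas G) (atlas G) (m_inv G)" using G by (simp add: lie_group_def)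
  then obtain M where M: "x \<in> M" "\<And>y. y \<in> M \<Longrightarrow> inv\<^bsub>G\<^esub> f y \<in> W"
    "twice_differentiable_on M (\<lambda>y. \<xi> (inv\<^bsub>G\<^esub> f y))"
    by (rule twice_differentiable_into_in_chart[where F = "m_inv G", OF f G _ W]) (blast intro: that)
  show ?thesis using twice_differentiable_intoI[OF W(1) M] .
qed

lemma twice_differentiable_into_const:
  assumes "lie_group G" "g \<in> carrier G"
  shows "twice_differentiable_into G (\<lambda>x. g) x"
proof -
  obtain U \<phi> where "(U, \<phi>) \<in> atlas G" "g \<in> U" using lie_group_obtain_chart[OF assms] .
  then show ?thesis
    by (intro twice_differentiable_intoI[of U \<phi> G x UNIV]) (auto intro: twice_differentiable_on_const)
qed

lemma twice_differentiable_into_id_param: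
  fixes G :: "('g, 'e::euclidean_space) lie_group_data"
  assumes G: "lie_group G" and l: "bounded_linear l" "l x = id_coord G \<one>\<^bsub>G\<^esub>"
  shows "twice_differentiable_into G (\<lambda>y. id_param G (l y)) x"
proof (rule twice_differentiable_intoI[OF id_chart_props(1)[OF G], of _ "l -` (id_coord G ` fst (id_chart G))"])
  let ?N = "l -` (id_coord G ` fst (id_chart G))"
  show "x \<in> ?N" using id_chart(2)[OF G] l by auto
  have N: "open ?N"
    using id_chart_props(2)[OF G] linear_continuous_on[OF l(1), of UNIV] by (simp add: open_vimage)
  show "id_param G (l y) \<in> fst (id_chart G)" if "y \<in> ?N" for y
    using that by (auto simp: inv_into_into)
  show "twice_differentiable_on ?N (\<lambda>y. id_coord G (id_param G (l y)))"
    by (rule twice_differentiable_on_cong[OF twice_differentiable_on_bounded_linear[OF l(1) N]])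
      (auto simp: f_inv_into_f)
qed

locale real_lie_group =
  fixes G :: "('g, 'e::euclidean_space) lie_group_data" (structure)
  assumes lie_group: "lie_group G"
begin

sublocale group G using lie_group by (rule lie_group_group)

abbreviation e0 :: 'e where "e0 \<equiv> id_coord G \<one>"
abbreviation chart_dom :: "'g set" where "chart_dom \<equiv> fst (id_chart G)"

lemmas chart_atlas = id_chart_props(1)[OF lie_group]
lemmas chart_open = id_chart_props(2)[OF lie_group]
lemmas chart_inj = id_chart_props(3)[OF lie_group]
lemmas chart_carrier = id_chart_props(4)[OF lie_group]
lemmas chart_one = id_chart(2)[OF lie_group]

lemma id_param_coord: "x \<in> chart_dom \<Longrightarrow> id_param G (id_coord G x) = x"
  using chart_inj by (simp add: inv_into_f_f)

lemma id_param_e0 [simp]: "id_param G e0 = \<one>"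
  using chart_one by (simp add: id_param_coord)

text \<open>Used with constant \<open>f\<close> for \<open>Ad g\<close>, and with \<open>f\<close> and \<open>l\<close> reading the two components of a pair for
  the dependence of \<open>Ad g\<close> on \<open>g\<close>.\<close>

lemma conjugation_twice_differentiable:
  assumes l: "bounded_linear l" "l x = e0" and f: "twice_differentiable_into G f x"
    and fx: "f x \<in> carrier G"
  obtains M where "open M" "x \<in> M"
    "\<And>y. y \<in> M \<Longrightarrow> f y \<otimes> id_param G (l y) \<otimes> inv (f y) \<in> chart_dom"
    "twice_differentiable_on M (\<lambda>y. id_coord G (f y \<otimes> id_param G (l y) \<otimes> inv (f y)))"
proof -
  have 1: "twice_differentiable_into G (\<lambda>y. f y \<otimes> id_param G (l y)) x"
    by (rule twice_differentiable_into_mult[OF lie_group f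
          twice_differentiable_into_id_param[OF lie_group l]])
  have 2: "twice_differentiable_into G (\<lambda>y. inv (f y)) x"
    by (rule twice_differentiable_into_inv[OF lie_group f])
  have "f x \<otimes> id_param G (l x) \<otimes> inv (f x) \<in> chart_dom"
    using fx chart_one by (simp add: l)
  then show ?thesis
    by (rule twice_differentiable_into_mult_in_chart[OF lie_group 1 2 chart_atlas])
      (rule that, auto simp: twice_differentiable_on_def)
qed

lemma Ad_has_derivative:
  assumes g: "g \<in> carrier G"
  shows "((\<lambda>u. id_coord G (g \<otimes> id_param G u \<otimes> inv g)) has_derivative Ad G g) (at e0)"
    and "\<exists>M. open M \<and> e0 \<in> M \<and> (\<forall>u\<in>M. g \<otimes> id_param G u \<otimes> inv g \<in> chart_dom)"
proof -
  obtain M where M: "open M" "e0 \<in> M"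
    "\<And>u. u \<in> M \<Longrightarrow> g \<otimes> id_param G u \<otimes> inv g \<in> chart_dom"
    "twice_differentiable_on M (\<lambda>u. id_coord G (g \<otimes> id_param G u \<otimes> inv g))"
    by (rule conjugation_twice_differentiable[OF bounded_linear_ident refl
        twice_differentiable_into_const[OF lie_group g] g]) blast
  then show "\<exists>M. open M \<and> e0 \<in> M \<and> (\<forall>u\<in>M. g \<otimes> id_param G u \<otimes> inv g \<in> chart_dom)"
    by blast
  show "((\<lambda>u. id_coord G (g \<otimes> id_param G u \<otimes> inv g)) has_derivative Ad G g) (at e0)"
    using has_derivative_frechet[OF M(4,2)] by (simp add: Ad_def diff_at_id_def comp_def)
qed

text \<open>\<open>Ad (p u) Y\<close> is the partial derivative at \<open>(u, e0)\<close> in the direction \<open>(0, Y)\<close> of the map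
  \<open>(u, v) \<mapsto> p u * p v * (p u)\<inverse>\<close> read in the chart, where \<open>p\<close> is the inverse of the chart.  This
  map is twice differentiable, so its partial derivative is differentiable in \<open>u\<close>.\<close>

lemma lie_bracket_has_derivative:
  "((\<lambda>u. Ad G (id_param G u) Y) has_derivative (\<lambda>X. lie_bracket G X Y)) (at e0)"
proof -
  let ?f = "\<lambda>y :: 'e \<times> 'e. id_param G (fst y) \<otimes> id_param G (snd y) \<otimes> inv (id_param G (fst y))"
  let ?F = "\<lambda>y. id_coord G (?f y)"
  have 1: "twice_differentiable_into G (\<lambda>y :: 'e \<times> 'e. id_param G (fst y)) (e0, e0)"
    by (rule twice_differentiable_into_id_param[OF lie_group bounded_linear_fst]) simp
  obtain M where M: "open M" "(e0, e0) \<in> M" "\<And>y. y \<in> M \<Longrightarrow> ?f y \<in> chart_dom"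
    "twice_differentiable_on M ?F"
    by (rule conjugation_twice_differentiable[OF bounded_linear_snd _ 1]) auto
  define N where "N = (\<lambda>u. (u, e0)) -` M"
  have N: "open N"
    unfolding N_def using M(1) by (intro open_vimage continuous_intros)
  have Nmem: "e0 \<in> N" using M(2) by (simp add: N_def)
  have Ad: "Ad G (id_param G u) Y = frechet_derivative ?F (at (u, e0)) (0, Y)" if u: "u \<in> N" for u
  proof -
    have "((\<lambda>v. (u, v)) has_derivative (\<lambda>w. (0, w))) (at e0)"
      by (auto intro!: derivative_eq_intros)
    moreover have "(?F has_derivative frechet_derivative ?F (at (u, e0))) (at (u, e0))"
      using has_derivative_frechet[OF M(4)] u by (simp add: N_def)
    ultimately have "((?F \<circ> (\<lambda>v. (u, v))) has_derivative
        frechet_derivative ?F (at (u, e0)) \<circ> (\<lambda>w. (0, w))) (at e0)"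
      by (rule diff_chain_at)
    from frechet_derivative_at[OF this] show ?thesis
      unfolding Ad_def diff_at_id_def by (simp add: comp_def fun_eq_iff)
  qed
  have "(\<lambda>y. frechet_derivative ?F (at y) (0, Y)) differentiable (at (e0, e0))"
    using M(2,4) by (simp add: twice_differentiable_on_def)
  moreover have "(\<lambda>u. (u, e0)) differentiable (at e0)"
    unfolding differentiable_def by (auto intro!: derivative_eq_intros)
  ultimately have "(\<lambda>u. frechet_derivative ?F (at (u, e0)) (0, Y)) differentiable (at e0)"
    using differentiable_chain_at[of "\<lambda>u. (u, e0)" e0 "\<lambda>y. frechet_derivative ?F (at y) (0, Y)"]
    by (simp add: comp_def)
  then have "(\<lambda>u. Ad G (id_param G u) Y) differentiable (at e0)"
    by (rule differentiable_cong_open[OF _ N Nmem]) (simp add: Ad)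
  then show ?thesis
    by (simp add: lie_bracket_def diff_at_id_def comp_def frechet_derivative_works)
qed

lemma linear_Ad: "g \<in> carrier G \<Longrightarrow> linear (Ad G g)"
  using Ad_has_derivative(1) has_derivative_linear by blast

end

section \<open>Differentials of representations\<close>

lemma bounded_bilinear_matrix_mult:
  "bounded_bilinear ((**) :: complex^'n^'m \<Rightarrow> complex^'k^'n \<Rightarrow> complex^'k^'m)"
  by (simp add: bilinear_conv_bounded_bilinear[symmetric] bilinear_def)
    (auto intro!: linearI simp: vec_eq_iff
      matrix_matrix_mult_def scaleR_sum_right sum.distrib ring_distribs)

lemmas matrix_bilinear_simps =
  bounded_bilinear.add_left[OF bounded_bilinear_matrix_mult]
  bounded_bilinear.add_right[OF bounded_bilinear_matrix_mult]
  bounded_bilinear.diff_left[OF bounded_bilinear_matrix_mult]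
  bounded_bilinear.diff_right[OF bounded_bilinear_matrix_mult]
  bounded_bilinear.minus_left[OF bounded_bilinear_matrix_mult]
  bounded_bilinear.minus_right[OF bounded_bilinear_matrix_mult]
  bounded_bilinear.zero_left[OF bounded_bilinear_matrix_mult]
  bounded_bilinear.zero_right[OF bounded_bilinear_matrix_mult]
  bounded_bilinear.scaleR_left[OF bounded_bilinear_matrix_mult]
  bounded_bilinear.scaleR_right[OF bounded_bilinear_matrix_mult]

lemma linear_matrix_mult_left: "linear (\<lambda>X :: complex^'n^'n. A ** X ** B)"
  by (intro linearI) (simp_all add: matrix_bilinear_simps)

locale matrix_representation = real_lie_group G
  for G :: "('g, 'e::euclidean_space) lie_group_data" (structure) +
  fixes \<tau> :: "'g \<Rightarrow> complex^'n^'n"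
  assumes rep: "smooth_representation G \<tau>"
begin

abbreviation d\<tau> :: "'e \<Rightarrow> complex^'n^'n" where "d\<tau> \<equiv> diff_at_id G \<tau>"

lemma rep_mult: "x \<in> carrier G \<Longrightarrow> y \<in> carrier G \<Longrightarrow> \<tau> (x \<otimes> y) = \<tau> x ** \<tau> y"
  using rep by (simp add: smooth_representation_def hom_def SL_def)

lemma rep_one: "\<tau> \<one> = mat 1"
proof -
  have "det (\<tau> \<one>) = 1"
    using rep one_closed unfolding smooth_representation_def hom_def SL_def by (auto simp: Pi_def)
  then obtain B where B: "\<tau> \<one> ** B = mat 1"
    using invertible_det_nz[of "\<tau> \<one>"] invertible_right_inverse by fastforce
  have "\<tau> \<one> ** \<tau> \<one> = \<tau> \<one>" using rep_mult[OF one_closed one_closed] by simp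
  then have "\<tau> \<one> ** (\<tau> \<one> ** B) = \<tau> \<one> ** B" by (simp add: matrix_mul_assoc)
  then show ?thesis by (simp add: B)
qed

lemma rep_inv:
  assumes "g \<in> carrier G"
  shows "\<tau> g ** \<tau> (inv g) = mat 1" "\<tau> (inv g) ** \<tau> g = mat 1"
  using assms by (simp_all flip: rep_mult add: rep_one)

lemma rep_smooth: "smooth_map (atlas G) {(UNIV, id)} \<tau>"
  using rep by (simp add: smooth_representation_def vector_space_atlas_def)

lemma rep_has_derivative: "((\<lambda>u. \<tau> (id_param G u)) has_derivative d\<tau>) (at e0)"
proof -
  obtain M where "e0 \<in> M" "twice_differentiable_on M (\<lambda>u. id (\<tau> (id_param G u)))"
    by (rule twice_differentiable_into_in_chart[where F = \<tau> and V = UNIV and \<psi> = id,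
          OF twice_differentiable_into_id_param[OF lie_group bounded_linear_ident refl]
            lie_group rep_smooth]) auto
  from has_derivative_frechet[OF this(2,1)] show ?thesis
    by (simp add: diff_at_id_def comp_def)
qed

lemma linear_d\<tau>: "linear d\<tau>" "bounded_linear d\<tau>"
  using rep_has_derivative by (auto dest: has_derivative_linear has_derivative_bounded_linear)

text \<open>Differentiate \<open>\<tau> (g x g\<inverse>) = \<tau> g ** \<tau> x ** \<tau> (g\<inverse>)\<close> in \<open>x\<close> at the identity.\<close>

lemma d\<tau>_Ad:
  assumes g: "g \<in> carrier G"
  shows "d\<tau> (Ad G g X) = \<tau> g ** d\<tau> X ** \<tau> (inv g)"
proof -
  let ?c = "\<lambda>u. id_coord G (g \<otimes> id_param G u \<otimes> inv g)"
  obtain M where M: "open M" "e0 \<in> M" "\<And>u. u \<in> M \<Longrightarrow> g \<otimes> id_param G u \<otimes> inv g \<in> chart_dom"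
    using Ad_has_derivative(2)[OF g] by blast
  define M' where "M' = M \<inter> id_coord G ` chart_dom"
  have M': "open M'" "e0 \<in> M'" using M chart_open chart_one by (auto simp: M'_def)
  have "?c e0 = e0" using g by simp
  then have "((\<lambda>u. \<tau> (id_param G u)) has_derivative d\<tau>) (at (?c e0))"
    using rep_has_derivative by simp
  from diff_chain_at[OF Ad_has_derivative(1)[OF g] this]
  have "((\<lambda>u. \<tau> (id_param G (?c u))) has_derivative (\<lambda>X. d\<tau> (Ad G g X))) (at e0)"
    by (simp add: comp_def)
  moreover have "\<tau> (id_param G (?c u)) = \<tau> g ** \<tau> (id_param G u) ** \<tau> (inv g)" if "u \<in> M'" for u
  proof -
    have "id_param G u \<in> carrier G"
      using that chart_carrier by (auto simp: M'_def id_param_coord)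
    then show ?thesis
      using that M(3) g by (simp add: M'_def id_param_coord rep_mult)
  qed
  ultimately have 1: "((\<lambda>u. \<tau> g ** \<tau> (id_param G u) ** \<tau> (inv g)) has_derivative
      (\<lambda>X. d\<tau> (Ad G g X))) (at e0)"
    by (rule has_derivative_transform_within_open[OF _ M'])
  have "bounded_linear (\<lambda>X. \<tau> g ** X ** \<tau> (inv g))"
    using linear_matrix_mult_left by (simp add: linear_conv_bounded_linear)
  from bounded_linear.has_derivative[OF this rep_has_derivative]
  have "((\<lambda>u. \<tau> g ** \<tau> (id_param G u) ** \<tau> (inv g)) has_derivative
      (\<lambda>X. \<tau> g ** d\<tau> X ** \<tau> (inv g))) (at e0)" .
  from has_derivative_unique[OF 1 this] show ?thesis by metis
qed

text \<open>Differentiate \<open>d\<tau> (Ad g Y) ** \<tau> g = \<tau> g ** d\<tau> Y\<close> in \<open>g\<close> at the identity.\<close>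

lemma d\<tau>_lie_bracket: "d\<tau> (lie_bracket G X Y) = d\<tau> X ** d\<tau> Y - d\<tau> Y ** d\<tau> X"
proof -
  let ?p = "id_param G"
  have 1: "((\<lambda>u. d\<tau> (Ad G (?p u) Y) ** \<tau> (?p u)) has_derivative
     (\<lambda>X. d\<tau> (Ad G (?p e0) Y) ** d\<tau> X + d\<tau> (lie_bracket G X Y) ** \<tau> (?p e0))) (at e0)"
    by (rule bounded_bilinear.FDERIV[OF bounded_bilinear_matrix_mult
          bounded_linear.has_derivative[OF linear_d\<tau>(2) lie_bracket_has_derivative]
          rep_has_derivative])
  have "((\<lambda>u. \<tau> (?p u) ** d\<tau> Y) has_derivative (\<lambda>X. d\<tau> X ** d\<tau> Y)) (at e0)"
    using bounded_linear.has_derivative[OF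
        bounded_bilinear.bounded_linear_left[OF bounded_bilinear_matrix_mult] rep_has_derivative] .
  moreover have "\<tau> (?p u) ** d\<tau> Y = d\<tau> (Ad G (?p u) Y) ** \<tau> (?p u)"
    if "u \<in> id_coord G ` chart_dom" for u
  proof -
    have "?p u \<in> carrier G" using that chart_carrier by (auto simp: id_param_coord)
    then show ?thesis by (simp add: d\<tau>_Ad rep_inv flip: matrix_mul_assoc)
  qed
  ultimately have 2: "((\<lambda>u. d\<tau> (Ad G (?p u) Y) ** \<tau> (?p u)) has_derivative
      (\<lambda>X. d\<tau> X ** d\<tau> Y)) (at e0)"
    by (rule has_derivative_transform_within_open[OF _ chart_open imageI[OF chart_one]])
  have "d\<tau> (Ad G \<one> Y) = d\<tau> Y" by (simp add: d\<tau>_Ad rep_one)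
  then show ?thesis
    using fun_cong[OF has_derivative_unique[OF 1 2], of X]
    by (simp add: rep_one algebra_simps)
qed

lemma continuous_rep: "continuous_map (topo G) euclidean \<tau>"
  unfolding continuous_map
proof (intro conjI allI impI)
  fix W :: "(complex^'n^'n) set" assume W: "openin euclidean W"
  show "openin (topo G) {x \<in> topspace (topo G). \<tau> x \<in> W}"
  proof (subst openin_subopen, intro ballI)
    fix x assume x: "x \<in> {x \<in> topspace (topo G). \<tau> x \<in> W}"
    have top: "topspace (topo G) = carrier G" using lie_group by (simp add: lie_group_def)
    then obtain U \<phi> where U: "(U, \<phi>) \<in> atlas G" "x \<in> U"
      using x by (auto intro: lie_group_obtain_chart[OF lie_group])
    note U' = lie_group_chart[OF lie_group U(1)]
    have "smooth_on (\<phi> ` (U \<inter> \<tau> -` UNIV)) (id \<circ> \<tau> \<circ> inv_into U \<phi>)"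
      using bspec[OF bspec[OF conjunct2[OF rep_smooth[unfolded smooth_map_def]] U(1),
          unfolded prod.case], of "(UNIV, id)"] by simp
    then have "Ck_on 0 (\<phi> ` U) (\<tau> \<circ> inv_into U \<phi>)"
      unfolding smooth_on_def by simp
    then have "continuous_map (top_of_set (\<phi> ` U)) euclidean (\<tau> \<circ> inv_into U \<phi>)"
      by simp
    from continuous_map_compose[OF homeomorphic_imp_continuous_map[OF U'(5)] this]
    have "continuous_map (subtopology (topo G) U) euclidean (\<tau> \<circ> inv_into U \<phi> \<circ> \<phi>)"
      by (simp add: comp_assoc)
    then have "continuous_map (subtopology (topo G) U) euclidean \<tau>"
      by (rule continuous_map_eq) (use U' in \<open>simp add: inv_into_f_f\<close>)
    then have "openin (subtopology (topo G) U)
        {x \<in> topspace (subtopology (topo G) U). \<tau> x \<in> W}"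
      using W by (simp add: continuous_map)
    then have "openin (topo G) {x \<in> topspace (subtopology (topo G) U). \<tau> x \<in> W}"
      using U'(2) by (rule openin_trans_full)
    then show "\<exists>T. openin (topo G) T \<and> x \<in> T \<and> T \<subseteq> {x \<in> topspace (topo G). \<tau> x \<in> W}"
      using x U(2) by (intro exI[of _ "{x \<in> topspace (subtopology (topo G) U). \<tau> x \<in> W}"]) auto
  qed
qed auto

text \<open>The group law carries the derivative at \<open>0\<close> to every time.\<close>

lemma one_parameter_subgroup:
  assumes Z: "Z \<in> lie_algebra_of_subgroup G K" and K: "K \<subseteq> carrier G"
  obtains \<gamma> :: "real \<Rightarrow> 'g" where "range \<gamma> \<subseteq> K" "\<gamma> 0 = \<one>" "\<And>s t. \<gamma> (s + t) = \<gamma> s \<otimes> \<gamma> t"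
    "((\<lambda>t. id_coord G (\<gamma> t)) has_vector_derivative Z) (at 0)"
    "\<And>t. ((\<lambda>t. \<tau> (\<gamma> t)) has_vector_derivative \<tau> (\<gamma> t) ** d\<tau> Z) (at t)"
proof -
  obtain \<gamma> :: "real \<Rightarrow> 'g" where \<gamma>: "smooth_map {(UNIV, id)} (atlas G) \<gamma>"
      "\<And>s t. \<gamma> (s + t) = \<gamma> s \<otimes> \<gamma> t"
      "((\<lambda>t. id_coord G (\<gamma> t)) has_vector_derivative Z) (at 0)" "range \<gamma> \<subseteq> K"
    using Z unfolding lie_algebra_of_subgroup_def vector_space_atlas_def by auto
  have car: "\<gamma> t \<in> carrier G" for t using \<gamma>(4) K by auto
  have \<gamma>0: "\<gamma> 0 = \<one>"
    using \<gamma>(2)[of 0 0] car[of 0] by (metis add_0 l_cancel_one')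
  define N where "N = \<gamma> -` chart_dom"
  have "\<forall>(V, \<psi>)\<in>atlas G. open (id ` (UNIV \<inter> \<gamma> -` V)) \<and>
      smooth_on (id ` (UNIV \<inter> \<gamma> -` V)) (\<psi> \<circ> \<gamma> \<circ> inv_into UNIV id)"
    using conjunct2[OF \<gamma>(1)[unfolded smooth_map_def]] by simp
  from bspec[OF this chart_atlas] have "open N" by (simp add: N_def case_prod_unfold)
  then have N: "open N" "0 \<in> N" using \<gamma>0 chart_one by (auto simp: N_def)
  have "((\<lambda>u. \<tau> (id_param G u)) has_derivative d\<tau>) (at (id_coord G (\<gamma> 0)))"
    using rep_has_derivative by (simp add: \<gamma>0)
  from diff_chain_at[OF \<gamma>(3)[unfolded has_vector_derivative_def] this]
  have "((\<lambda>t. \<tau> (id_param G (id_coord G (\<gamma> t)))) has_vector_derivative d\<tau> Z) (at 0)"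
    by (simp add: comp_def has_vector_derivative_def linear_cmul[OF linear_d\<tau>(1)])
  then have 0: "((\<lambda>t. \<tau> (\<gamma> t)) has_vector_derivative d\<tau> Z) (at 0)"
    by (rule has_vector_derivative_transform_within_open[OF _ N])
      (simp add: N_def id_param_coord)
  have "((\<lambda>t. \<tau> (\<gamma> t)) has_vector_derivative \<tau> (\<gamma> t) ** d\<tau> Z) (at t)" for t
  proof -
    have "((\<lambda>s. - t + s) has_vector_derivative 1) (at t)"
      by (auto intro!: derivative_eq_intros)
    then have "((\<lambda>s. \<tau> (\<gamma> (- t + s))) has_vector_derivative d\<tau> Z) (at t)"
      using vector_diff_chain_at[of "\<lambda>s. - t + s" 1 t "\<lambda>t. \<tau> (\<gamma> t)" "d\<tau> Z"] 0
      by (simp add: comp_def)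
    from bounded_linear.has_vector_derivative[OF
        bounded_bilinear.bounded_linear_right[OF bounded_bilinear_matrix_mult] this, of "\<tau> (\<gamma> t)"]
    have "((\<lambda>s. \<tau> (\<gamma> t) ** \<tau> (\<gamma> (- t + s))) has_vector_derivative \<tau> (\<gamma> t) ** d\<tau> Z) (at t)" .
    moreover have "\<tau> (\<gamma> t) ** \<tau> (\<gamma> (- t + s)) = \<tau> (\<gamma> s)" for s
      using car \<gamma>(2)[of t "- t + s"] by (simp flip: rep_mult)
    ultimately show ?thesis by simp
  qed
  then show ?thesis using that \<gamma> \<gamma>0 by blast
qed

end

section \<open>Hermitian scalar products and adjoint matrices\<close>

lemma hermitian_scalar_productD:
  assumes "hermitian_scalar_product h"
  shows "h (u + v) w = h u w + h v w" "h (c *s v) w = c * h v w" "h w v = cnj (h v w)"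
    "h w (u + v) = h w u + h w v" "h w (c *s v) = cnj c * h w v"
    "v \<noteq> 0 \<Longrightarrow> Re (h v v) > 0"
proof -
  show 1: "h (u + v) w = h u w + h v w" for u v w
    using assms unfolding hermitian_scalar_product_def by blast
  show 2: "h (c *s v) w = c * h v w" for c v w
    using assms unfolding hermitian_scalar_product_def by blast
  show 3: "h w v = cnj (h v w)" for v w
    using assms unfolding hermitian_scalar_product_def by blast
  show "h w (u + v) = h w u + h w v" using 1 3 by (metis complex_cnj_add)
  show "h w (c *s v) = cnj c * h w v" using 2 3 by (metis complex_cnj_mult)
  show "v \<noteq> 0 \<Longrightarrow> Re (h v v) > 0" using assms unfolding hermitian_scalar_product_def by blast
qed

lemma hermitian_scalar_product_zero:
  assumes "hermitian_scalar_product h"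
  shows "h 0 w = 0" "h w 0 = 0"
  using hermitian_scalar_productD(2)[OF assms, of 0 0 w]
    hermitian_scalar_productD(5)[OF assms, of w 0 0] by simp_all

lemma hermitian_scalar_product_sum:
  assumes h: "hermitian_scalar_product h"
  shows "h (\<Sum>i\<in>I. f i) w = (\<Sum>i\<in>I. h (f i) w)" "h w (\<Sum>i\<in>I. f i) = (\<Sum>i\<in>I. h w (f i))"
  by (induction I rule: infinite_finite_induct,
      auto simp: hermitian_scalar_product_zero[OF h] hermitian_scalar_productD(1,4)[OF h])

text \<open>Gram--Schmidt orthonormalisation, indexed by the coordinates of the space.\<close>

lemma hermitian_orthonormal_family:
  fixes h :: "complex^'n \<Rightarrow> complex^'n \<Rightarrow> complex"
  assumes h: "hermitian_scalar_product h" and "finite I"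
  shows "\<exists>e :: 'n \<Rightarrow> complex^'n. \<forall>i\<in>I. \<forall>j\<in>I. h (e i) (e j) = (if i = j then 1 else 0)"
  using \<open>finite I\<close>
proof induction
  case empty
  then show ?case by simp
next
  case (insert k I)
  note hs = hermitian_scalar_productD[OF h]
  obtain e :: "'n \<Rightarrow> complex^'n" where e: "\<And>i j. i \<in> I \<Longrightarrow> j \<in> I \<Longrightarrow> h (e i) (e j) = (if i = j then 1 else 0)"
    using insert.IH by blast
  have "vec.dim (vec.span (e ` I)) \<le> card (e ` I)"
    using insert.hyps by (simp add: vec.dim_span vec.dim_le_card')
  also have "\<dots> \<le> card I" using insert.hyps by (simp add: card_image_le)
  also have "\<dots> < CARD('n)"
    using insert.hyps by (intro psubset_card_mono) auto
  finally have "vec.span (e ` I) \<noteq> UNIV"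
    using vec_dim_card[where 'a = complex and 'n = 'n] by (metis less_irrefl)
  then obtain v where v: "v \<notin> vec.span (e ` I)" by blast
  define s where "s = (\<Sum>i\<in>I. (- h v (e i)) *s e i)"
  define w where "w = v + s"
  have s: "s \<in> vec.span (e ` I)"
    unfolding s_def by (intro vec.span_sum vec.span_scale vec.span_base) auto
  have "w \<noteq> 0"
  proof
    assume "w = 0"
    then have "v = - s" by (simp add: w_def eq_neg_iff_add_eq_0)
    then show False using v vec.span_neg[OF s] by simp
  qed
  then have pos: "Re (h w w) > 0" by (rule hs(6))
  have real: "h w w = of_real (Re (h w w))"
    using arg_cong[OF hs(3)[of w w], of Im] by (simp add: complex_eq_iff)
  have orth: "h w (e j) = 0" if j: "j \<in> I" for j
  proof -
    have "h w (e j) = h v (e j) + (\<Sum>i\<in>I. - h v (e i) * (if i = j then 1 else 0))"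
      unfolding w_def s_def hs(1,2) hermitian_scalar_product_sum[OF h]
      by (intro arg_cong2[where f = "(+)"] sum.cong refl) (simp add: e j)
    also have "\<dots> = 0" using j insert.hyps by (simp add: if_distrib sum.delta cong: if_cong)
    finally show ?thesis .
  qed
  define r where "r = Re (h w w)"
  define c where "c = complex_of_real (1 / sqrt r)"
  have "c * cnj c * h w w = complex_of_real (1 / sqrt r * (1 / sqrt r) * r)"
    using real by (simp only: c_def r_def[symmetric] complex_cnj_complex_of_real of_real_mult)
  also have "1 / sqrt r * (1 / sqrt r) * r = 1"
    using pos by (simp add: r_def field_simps)
  finally have "c * cnj c * h w w = 1" by simp
  then have norm: "h (c *s w) (c *s w) = 1" by (simp add: hs(2,5) mult_ac)
  have "h (e j) w = 0" if "j \<in> I" for j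
    using orth[OF that] hs(3)[where w = "e j" and v = w] by simp
  then have "\<forall>i\<in>insert k I. \<forall>j\<in>insert k I.
      h ((e(k := c *s w)) i) ((e(k := c *s w)) j) = (if i = j then 1 else 0)"
    using insert.hyps e orth norm by (auto simp: hs(2,5))
  then show ?case by blast
qed

lemma hermitian_orthonormal_frame:
  fixes h :: "complex^'n \<Rightarrow> complex^'n \<Rightarrow> complex"
  assumes h: "hermitian_scalar_product h"
  obtains T :: "complex^'n^'n" where "invertible T"
    "\<And>x y. h (T *v x) (T *v y) = (\<Sum>i\<in>UNIV. x $ i * cnj (y $ i))"
proof -
  note hs = hermitian_scalar_productD[OF h]
  obtain e :: "'n \<Rightarrow> complex^'n" where e: "\<And>i j. h (e i) (e j) = (if i = j then 1 else 0)"
    using hermitian_orthonormal_family[OF h, of UNIV] by auto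
  define T :: "complex^'n^'n" where "T = (\<chi> i j. e j $ i)"
  have col: "column j T = e j" for j by (simp add: column_def T_def vec_eq_iff)
  have T: "T *v x = (\<Sum>j\<in>UNIV. x $ j *s e j)" for x
    by (simp add: matrix_mult_sum col)
  have hT: "h (T *v x) (T *v y) = (\<Sum>i\<in>UNIV. x $ i * cnj (y $ i))" for x y
    by (simp add: T hermitian_scalar_product_sum[OF h] hs(2,5) e if_distrib sum.delta mult.commute cong: if_cong)
  have "x = 0" if "T *v x = 0" for x
  proof -
    have "(\<Sum>i\<in>UNIV. x $ i * cnj (x $ i)) = 0"
      using hT[of x x] that by (simp add: hermitian_scalar_product_zero[OF h])
    then have "(\<Sum>i\<in>UNIV. (cmod (x $ i))\<^sup>2) = 0"
      by (simp only: complex_norm_square[symmetric] of_real_sum[symmetric] of_real_eq_0_iff)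
    then show ?thesis by (simp add: sum_nonneg_eq_0_iff vec_eq_iff)
  qed
  then have "invertible T"
    using matrix_left_invertible_ker invertible_left_inverse by blast
  then show ?thesis using that hT by blast
qed

definition conj_transpose :: "complex^'n^'m \<Rightarrow> complex^'m^'n" where
  "conj_transpose A = (\<chi> i j. cnj (A $ j $ i))"

lemma inner_complex_Re: "x \<bullet> y = Re (x * cnj y)" for x y :: complex
  by (simp add: inner_complex_def)

lemma inner_matrix_mult_left:
  fixes A B C :: "complex^'n^'n"
  shows "(A ** B) \<bullet> C = B \<bullet> (conj_transpose A ** C)"
proof -
  have "(A ** B) \<bullet> C = (\<Sum>i\<in>UNIV. \<Sum>j\<in>UNIV. \<Sum>k\<in>UNIV. Re (A $ i $ k * B $ k $ j * cnj (C $ i $ j)))"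
    by (simp only: inner_vec_def inner_complex_Re matrix_matrix_mult_def vec_lambda_beta
        sum_distrib_right Re_sum)
  also have "\<dots> = (\<Sum>i\<in>UNIV. \<Sum>k\<in>UNIV. \<Sum>j\<in>UNIV. Re (A $ i $ k * B $ k $ j * cnj (C $ i $ j)))"
    by (rule sum.cong[OF refl], rule sum.swap)
  also have "\<dots> = (\<Sum>k\<in>UNIV. \<Sum>i\<in>UNIV. \<Sum>j\<in>UNIV. Re (A $ i $ k * B $ k $ j * cnj (C $ i $ j)))"
    by (rule sum.swap)
  also have "\<dots> = (\<Sum>k\<in>UNIV. \<Sum>j\<in>UNIV. \<Sum>i\<in>UNIV. Re (A $ i $ k * B $ k $ j * cnj (C $ i $ j)))"
    by (rule sum.cong[OF refl], rule sum.swap)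
  also have "\<dots> = B \<bullet> (conj_transpose A ** C)"
    by (simp only: inner_vec_def inner_complex_Re matrix_matrix_mult_def conj_transpose_def
        vec_lambda_beta cnj_sum sum_distrib_left Re_sum complex_cnj_mult complex_cnj_cnj mult.assoc
        mult.left_commute)
  finally show ?thesis .
qed

lemma conj_transpose_mult: "conj_transpose (A ** B) = conj_transpose B ** conj_transpose A"
  by (simp add: conj_transpose_def matrix_matrix_mult_def vec_eq_iff mult.commute)

lemma conj_transpose_conj_transpose [simp]: "conj_transpose (conj_transpose A) = A"
  by (simp add: conj_transpose_def vec_eq_iff)

lemma inner_conj_transpose: "conj_transpose A \<bullet> conj_transpose B = A \<bullet> B"
  for A B :: "complex^'n^'n"
  unfolding inner_vec_def conj_transpose_def by (subst sum.swap) (simp add: inner_complex_def)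

lemma inner_matrix_mult_right:
  fixes A B C :: "complex^'n^'n"
  shows "(A ** B) \<bullet> C = A \<bullet> (C ** conj_transpose B)"
proof -
  have "(A ** B) \<bullet> C = (conj_transpose B ** conj_transpose A) \<bullet> conj_transpose C"
    by (metis inner_conj_transpose conj_transpose_mult)
  also have "\<dots> = conj_transpose A \<bullet> (B ** conj_transpose C)"
    by (simp add: inner_matrix_mult_left)
  also have "\<dots> = A \<bullet> (C ** conj_transpose B)"
    by (metis inner_conj_transpose conj_transpose_mult conj_transpose_conj_transpose)
  finally show ?thesis .
qed

lemma inner_matrix_vector_mult:
  fixes A :: "complex^'n^'n"
  shows "(A *v x) \<bullet> y = x \<bullet> (conj_transpose A *v y)"
proof -
  have "(A *v x) \<bullet> y = (\<Sum>i\<in>UNIV. \<Sum>j\<in>UNIV. Re (A $ i $ j * x $ j * cnj (y $ i)))"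
    by (simp only: inner_vec_def inner_complex_Re matrix_vector_mult_def vec_lambda_beta
        sum_distrib_right Re_sum)
  also have "\<dots> = (\<Sum>j\<in>UNIV. \<Sum>i\<in>UNIV. Re (A $ i $ j * x $ j * cnj (y $ i)))"
    by (rule sum.swap)
  also have "\<dots> = x \<bullet> (conj_transpose A *v y)"
    by (simp only: inner_vec_def inner_complex_Re matrix_vector_mult_def conj_transpose_def
        vec_lambda_beta cnj_sum sum_distrib_left Re_sum complex_cnj_mult complex_cnj_cnj mult.assoc
        mult.left_commute)
  finally show ?thesis .
qed

text \<open>In an orthonormal frame the adjoint of an operator is the conjugate transpose.\<close>

lemma conj_transpose_eqI:
  fixes A B :: "complex^'n^'n"
  assumes "\<And>x y. (\<Sum>i\<in>UNIV. (A *v x) $ i * cnj (y $ i)) = (\<Sum>i\<in>UNIV. x $ i * cnj ((B *v y) $ i))"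
  shows "conj_transpose A = B"
proof -
  have *: "(M *v axis j 1) $ i = M $ i $ j" for M :: "complex^'n^'n" and i j
    
    by (simp add: matrix_vector_mult_def axis_def if_distrib cong: if_cong)
  have "A $ i $ j = cnj (B $ j $ i)" for i j
    using assms[of "axis j 1" "axis i 1"]
    unfolding * by (simp add: axis_def if_distrib if_distribR sum.delta cong: if_cong)
  then show ?thesis by (simp add: conj_transpose_def vec_eq_iff)
qed

section \<open>The differential of a compatible representation is injective\<close>

text \<open>The columns of \<open>T\<close> are orthonormal for \<open>h\<close>.  Writing the representation and its differential in this
  frame, as \<open>\<rho>\<close> and \<open>D\<close> below, turns adjoints with respect to \<open>h\<close> into conjugate transposes.\<close>

locale compatible_representation = matrix_representation G \<tau>
  for G :: "('g, 'e::euclidean_space) lie_group_data" (structure)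
    and \<tau> :: "'g \<Rightarrow> complex^'n^'n" +
  fixes K :: "'g set" and \<pp> :: "'e set" and h :: "complex^'n \<Rightarrow> complex^'n \<Rightarrow> complex"
    and T :: "complex^'n^'n"
  assumes subgroup_K: "subgroup K G"
    and compact_K: "compactin (topo G) K"
    and cartan: "cartan_decomposition G (lie_algebra_of_subgroup G K) \<pp>"
    and finite_kernel: "finite (kernel G SL \<tau>)"
    and hermitian: "hermitian_scalar_product h"
    and compatible: "compatible_rep G K \<pp> h \<tau>"
    and T_invertible: "invertible T"
    and T_frame: "\<And>x y. h (T *v x) (T *v y) = (\<Sum>i\<in>UNIV. x $ i * cnj (y $ i))"
begin

abbreviation \<kk> :: "'e set" where "\<kk> \<equiv> lie_algebra_of_subgroup G K"
abbreviation bracket :: "'e \<Rightarrow> 'e \<Rightarrow> 'e" where "bracket \<equiv> lie_bracket G"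

definition \<rho> :: "'g \<Rightarrow> complex^'n^'n" where "\<rho> g = matrix_inv T ** \<tau> g ** T"
definition D :: "'e \<Rightarrow> complex^'n^'n" where "D X = matrix_inv T ** d\<tau> X ** T"

lemma K_carrier: "K \<subseteq> carrier G"
  using subgroup_K by (rule subgroup.subset)

lemma K_closed: "k \<in> K \<Longrightarrow> k \<in> carrier G" "k \<in> K \<Longrightarrow> inv k \<in> K"
  using K_carrier subgroup_K by (auto simp: subgroup.m_inv_closed)

lemma cartan_props:
  shows "subspace \<kk>" "subspace \<pp>" "\<kk> \<inter> \<pp> = {0}"
    and "\<And>X Y. X \<in> \<kk> \<Longrightarrow> Y \<in> \<pp> \<Longrightarrow> bracket X Y \<in> \<pp>"
    and "\<And>X Y. X \<in> \<pp> \<Longrightarrow> Y \<in> \<pp> \<Longrightarrow> bracket X Y \<in> \<kk>"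
    and "\<And>X. X \<in> \<pp> \<Longrightarrow> X \<noteq> 0 \<Longrightarrow> killing_form G X X > 0"
    and "{X + Y | X Y. X \<in> \<kk> \<and> Y \<in> \<pp>} = UNIV"
  using cartan unfolding cartan_decomposition_def by blast+

lemma cartan_split:
  obtains Z P where "Z \<in> \<kk>" "P \<in> \<pp>" "X = Z + P"
  using cartan_props(7) by blast

lemma cartan_split_unique:
  assumes "Z \<in> \<kk>" "P \<in> \<pp>" "Z' \<in> \<kk>" "P' \<in> \<pp>" "Z + P = Z' + P'"
  shows "Z = Z'" "P = P'"
proof -
  have "Z - Z' = P' - P" using assms(5) by (simp add: algebra_simps)
  then have "Z - Z' \<in> \<kk> \<inter> \<pp>"
    using assms(1-4) cartan_props(1,2) by (metis IntI subspace_diff)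
  then show "Z = Z'" "P = P'" using cartan_props(3) assms(5) by auto
qed

lemma T_inv: "matrix_inv T ** T = mat 1" "T ** matrix_inv T = mat 1"
proof -
  have "T ** matrix_inv T = mat 1 \<and> matrix_inv T ** T = mat 1"
    using T_invertible unfolding invertible_def matrix_inv_def by (rule someI_ex)
  then show "matrix_inv T ** T = mat 1" "T ** matrix_inv T = mat 1" by simp_all
qed

lemma T_cancel: "T ** (matrix_inv T ** X) = X"
  by (simp add: matrix_mul_assoc T_inv)

lemma \<rho>_mult: "x \<in> carrier G \<Longrightarrow> y \<in> carrier G \<Longrightarrow> \<rho> (x \<otimes> y) = \<rho> x ** \<rho> y"
  by (simp add: \<rho>_def rep_mult T_cancel flip: matrix_mul_assoc)

lemma \<rho>_one: "\<rho> \<one> = mat 1"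
  by (simp add: \<rho>_def rep_one T_inv)

lemma \<rho>_inv: "g \<in> carrier G \<Longrightarrow> \<rho> g ** \<rho> (inv g) = mat 1" "g \<in> carrier G \<Longrightarrow> \<rho> (inv g) ** \<rho> g = mat 1"
  by (simp_all flip: \<rho>_mult add: \<rho>_one)

lemma linear_D: "linear D"
  using linear_compose[OF linear_d\<tau>(1) linear_matrix_mult_left] by (simp add: D_def[abs_def] comp_def)

lemmas D_simps = linear_add[OF linear_D] linear_diff[OF linear_D] linear_neg[OF linear_D]
  linear_cmul[OF linear_D] linear_0[OF linear_D]

lemma d\<tau>_D: "d\<tau> X = T ** D X ** matrix_inv T"
  by (simp add: D_def T_cancel T_inv flip: matrix_mul_assoc)

lemma D_Ad: "g \<in> carrier G \<Longrightarrow> D (Ad G g X) = \<rho> g ** D X ** \<rho> (inv g)"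
  by (simp add: D_def \<rho>_def d\<tau>_Ad T_cancel flip: matrix_mul_assoc)

lemma D_bracket: "D (bracket X Y) = D X ** D Y - D Y ** D X"
proof -
  have "D A ** D B = matrix_inv T ** (d\<tau> A ** d\<tau> B) ** T" for A B
    by (simp add: D_def T_cancel flip: matrix_mul_assoc)
  then show ?thesis
    by (simp add: D_def[of "bracket X Y"] d\<tau>_lie_bracket matrix_bilinear_simps)
qed

lemma T_\<rho>: "T *v (\<rho> g *v x) = \<tau> g *v (T *v x)"
  unfolding \<rho>_def by (simp add: matrix_vector_mul_assoc matrix_mul_assoc T_inv)

lemma T_D: "T *v (D X *v x) = d\<tau> X *v (T *v x)"
  unfolding D_def by (simp add: matrix_vector_mul_assoc matrix_mul_assoc T_inv)

lemma conj_transpose_\<rho>: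
  assumes k: "k \<in> K"
  shows "conj_transpose (\<rho> k) = \<rho> (inv k)"
proof (rule conj_transpose_eqI)
  fix x y
  have "h (\<tau> k *v v) (\<tau> k *v w) = h v w" for v w
    using compatible k by (auto simp: compatible_rep_def SU_def)
  then have "h (\<tau> k *v (T *v x)) (\<tau> k *v (\<tau> (inv k) *v (T *v y))) = h (T *v x) (\<tau> (inv k) *v (T *v y))"
    by blast
  then have "h (\<tau> k *v (T *v x)) (T *v y) = h (T *v x) (\<tau> (inv k) *v (T *v y))"
    using K_closed(1)[OF k] by (simp add: matrix_vector_mul_assoc matrix_mul_assoc rep_inv)
  then show "(\<Sum>i\<in>UNIV. (\<rho> k *v x) $ i * cnj (y $ i)) = (\<Sum>i\<in>UNIV. x $ i * cnj ((\<rho> (inv k) *v y) $ i))"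
    by (simp only: T_frame[symmetric] T_\<rho>)
qed

lemma conj_transpose_D_\<pp>:
  assumes X: "X \<in> \<pp>"
  shows "conj_transpose (D X) = D X"
proof (rule conj_transpose_eqI)
  fix x y
  note hs = hermitian_scalar_productD[OF hermitian]
  obtain A where A: "A \<in> su h" "d\<tau> X = (\<chi> j k. \<i> * A $ j $ k)"
    using compatible X unfolding compatible_rep_def i_su_def by blast
  have d: "d\<tau> X *v v = \<i> *s (A *v v)" for v
    by (simp add: A(2) matrix_vector_mult_def vec_eq_iff sum_distrib_left mult.assoc)
  have "h (A *v v) w = - h v (A *v w)" for v w
    using A(1) by (simp add: su_def eq_neg_iff_add_eq_0)
  then have "h (d\<tau> X *v (T *v x)) (T *v y) = h (T *v x) (d\<tau> X *v (T *v y))"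
    by (simp add: d hs(2,5))
  then show "(\<Sum>i\<in>UNIV. (D X *v x) $ i * cnj (y $ i)) = (\<Sum>i\<in>UNIV. x $ i * cnj ((D X *v y) $ i))"
    by (simp only: T_frame[symmetric] T_D)
qed

lemma linear_conj_transpose: "linear (conj_transpose :: complex^'m^'k \<Rightarrow> complex^'k^'m)"
  by (intro linearI) (simp_all add: conj_transpose_def vec_eq_iff)

lemma one_parameter_subgroup_\<rho>:
  assumes Z: "Z \<in> \<kk>"
  obtains \<gamma> :: "real \<Rightarrow> 'g" where "\<And>t. \<gamma> t \<in> K" "\<gamma> 0 = \<one>" "\<And>t. \<gamma> (- t) = inv (\<gamma> t)"
    "\<And>t. ((\<lambda>t. \<rho> (\<gamma> t)) has_vector_derivative \<rho> (\<gamma> t) ** D Z) (at t)"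
proof -
  obtain \<gamma> :: "real \<Rightarrow> 'g" where \<gamma>: "range \<gamma> \<subseteq> K" "\<gamma> 0 = \<one>" "\<And>s t. \<gamma> (s + t) = \<gamma> s \<otimes> \<gamma> t"
    "\<And>t. ((\<lambda>t. \<tau> (\<gamma> t)) has_vector_derivative \<tau> (\<gamma> t) ** d\<tau> Z) (at t)"
    by (rule one_parameter_subgroup[OF Z K_carrier]) blast
  have "bounded_linear (\<lambda>X. matrix_inv T ** X ** T)"
    using linear_matrix_mult_left by (simp add: linear_conv_bounded_linear)
  then have "((\<lambda>t. matrix_inv T ** \<tau> (\<gamma> t) ** T) has_vector_derivative
      matrix_inv T ** (\<tau> (\<gamma> t) ** d\<tau> Z) ** T) (at t)" for t
    using \<gamma>(4) by (rule bounded_linear.has_vector_derivative)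
  moreover have "matrix_inv T ** (\<tau> (\<gamma> t) ** d\<tau> Z) ** T = \<rho> (\<gamma> t) ** D Z" for t
    by (simp add: D_def \<rho>_def T_cancel flip: matrix_mul_assoc)
  ultimately have "((\<lambda>t. \<rho> (\<gamma> t)) has_vector_derivative \<rho> (\<gamma> t) ** D Z) (at t)" for t
    by (simp add: \<rho>_def)
  moreover have car: "\<gamma> t \<in> carrier G" for t using \<gamma>(1) K_carrier by auto
  moreover have "\<gamma> (- t) = inv (\<gamma> t)" for t
    using \<gamma>(3)[of "- t" t] \<gamma>(2) car by (simp add: inv_equality)
  ultimately show ?thesis using that[of \<gamma>] \<gamma>(1,2) by blast
qed

text \<open>Differentiate \<open>conj_transpose (\<rho> (\<gamma> t)) = \<rho> (\<gamma> (- t))\<close> at \<open>0\<close>.\<close>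

lemma conj_transpose_D_\<kk>:
  assumes Z: "Z \<in> \<kk>"
  shows "conj_transpose (D Z) = - D Z"
proof -
  obtain \<gamma> :: "real \<Rightarrow> 'g" where \<gamma>: "\<And>t. \<gamma> t \<in> K" "\<gamma> 0 = \<one>" "\<And>t. \<gamma> (- t) = inv (\<gamma> t)"
    "\<And>t. ((\<lambda>t. \<rho> (\<gamma> t)) has_vector_derivative \<rho> (\<gamma> t) ** D Z) (at t)"
    by (rule one_parameter_subgroup_\<rho>[OF Z]) blast
  have 0: "((\<lambda>t. \<rho> (\<gamma> t)) has_vector_derivative D Z) (at 0)"
    using \<gamma>(4)[of 0] by (simp add: \<gamma>(2) \<rho>_one)
  have "bounded_linear (conj_transpose :: complex^'n^'n \<Rightarrow> _)"
    using linear_conj_transpose by (simp add: linear_conv_bounded_linear)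
  from bounded_linear.has_vector_derivative[OF this 0]
  have 1: "((\<lambda>t. \<rho> (\<gamma> (- t))) has_vector_derivative conj_transpose (D Z)) (at 0)"
    by (simp add: conj_transpose_\<rho>[OF \<gamma>(1)] \<gamma>(3))
  have "((\<lambda>t. - t) has_vector_derivative (-1)) (at (0::real))"
    by (auto intro!: derivative_eq_intros)
  from vector_diff_chain_at[OF this, of "\<lambda>t. \<rho> (\<gamma> t)" "D Z"] 0
  have "((\<lambda>t. \<rho> (\<gamma> (- t))) has_vector_derivative - D Z) (at 0)"
    by (simp add: comp_def)
  with 1 show ?thesis by (rule vector_derivative_unique_at)
qed

text \<open>If \<open>d\<tau> Z = 0\<close>, the one-parameter subgroup of \<open>Z\<close> stays in the finite kernel of \<open>\<tau>\<close>, so it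
  is constant near \<open>0\<close>.\<close>

lemma D_inj_on_\<kk>:
  assumes Z: "Z \<in> \<kk>" and D0: "D Z = 0"
  shows "Z = 0"
proof -
  obtain \<gamma> :: "real \<Rightarrow> 'g" where \<gamma>: "range \<gamma> \<subseteq> K" "\<gamma> 0 = \<one>" "\<And>s t. \<gamma> (s + t) = \<gamma> s \<otimes> \<gamma> t"
    "((\<lambda>t. id_coord G (\<gamma> t)) has_vector_derivative Z) (at 0)"
    "\<And>t. ((\<lambda>t. \<tau> (\<gamma> t)) has_vector_derivative \<tau> (\<gamma> t) ** d\<tau> Z) (at t)"
    by (rule one_parameter_subgroup[OF Z K_carrier]) blast
  have "d\<tau> Z = 0" using D0 by (simp add: d\<tau>_D matrix_bilinear_simps)
  then have "((\<lambda>t. \<tau> (\<gamma> t)) has_derivative (\<lambda>x. 0)) (at t within UNIV)" for t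
    using \<gamma>(5)[of t] by (simp add: has_vector_derivative_def matrix_bilinear_simps)
  then have "\<exists>c. \<forall>t\<in>UNIV. \<tau> (\<gamma> t) = c"
    by (intro has_derivative_zero_constant) auto
  then have "\<tau> (\<gamma> t) = mat 1" for t
    using \<gamma>(2) rep_one by (metis UNIV_I)
  then have ker: "\<gamma> t \<in> kernel G SL \<tau>" for t
    using \<gamma>(1) K_carrier by (auto simp: kernel_def SL_def)
  define f where "f = (\<lambda>t. id_coord G (\<gamma> t))"
  define F where "F = id_coord G ` kernel G SL \<tau> - {f 0}"
  have "finite F" using finite_kernel by (simp add: F_def)
  then have "open (- F)" by (simp add: finite_imp_closed open_Compl)
  moreover have "f \<midarrow>0\<rightarrow> f 0"
    using has_vector_derivative_continuous[OF \<gamma>(4)] by (simp add: f_def continuous_within)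
  moreover have "f 0 \<in> - F" by (simp add: F_def)
  ultimately have "\<forall>\<^sub>F t in at 0. f t \<in> - F"
    using topological_tendstoD[of f "f 0" "at 0" "- F"] by blast
  then have ev: "\<forall>\<^sub>F t in at 0. f 0 = f t"
    by eventually_elim (use ker in \<open>auto simp: F_def f_def\<close>)
  have "((\<lambda>t. f 0) has_vector_derivative 0) (at 0)" by simp
  then have "(f has_vector_derivative 0) (at 0)"
    unfolding has_vector_derivative_def
    by (rule has_derivative_transform_eventually) (use ev in auto)
  then show ?thesis
    using vector_derivative_unique_at \<gamma>(4) unfolding f_def by blast
qed

text \<open>A matrix that is both Hermitian and skew-Hermitian vanishes, so the kernel of \<open>D\<close> is the sum of
  its parts in \<open>\<kk>\<close> and \<open>\<pp>\<close>, of which the former is zero.\<close>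

lemma D_kernel_subset_\<pp>:
  assumes "D X = 0"
  shows "X \<in> \<pp>"
proof -
  obtain Z P where ZP: "Z \<in> \<kk>" "P \<in> \<pp>" "X = Z + P" by (rule cartan_split)
  have s: "D Z + D P = 0" using assms by (simp add: ZP(3) D_simps)
  then have "conj_transpose (D Z) + conj_transpose (D P) = 0"
    by (metis linear_conj_transpose linear_add linear_0)
  then have "D P = D Z" by (simp add: conj_transpose_D_\<kk>[OF ZP(1)] conj_transpose_D_\<pp>[OF ZP(2)])
  then have "2 *\<^sub>R D Z = 0" using s by (simp add: scaleR_2)
  then have "Z = 0" using D_inj_on_\<kk>[OF ZP(1)] by simp
  then show ?thesis using ZP by simp
qed

text \<open>An element \<open>X\<close> of the kernel lies in \<open>\<pp>\<close>, and so does \<open>[X, W]\<close> for every \<open>W\<close>.  Hence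
  \<open>[X, [X, W]]\<close> lies in \<open>[\<pp>, \<pp>] \<subseteq> \<kk>\<close> and in the kernel, so \<open>(ad X)\<^sup>2 = 0\<close>.  This contradicts that
  the Killing form is positive on \<open>\<pp>\<close>, unless \<open>X = 0\<close>.\<close>

lemma D_eq_0:
  assumes D0: "D X = 0"
  shows "X = 0"
proof (rule ccontr)
  assume "X \<noteq> 0"
  have X: "X \<in> \<pp>" using D0 by (rule D_kernel_subset_\<pp>)
  have "bracket X (bracket X W) = 0" for W
  proof -
    have "bracket X W \<in> \<pp>"
      by (rule D_kernel_subset_\<pp>) (simp add: D_bracket D0 matrix_bilinear_simps)
    then have "bracket X (bracket X W) \<in> \<kk>" using cartan_props(5) X by blast
    then show ?thesis
      by (rule D_inj_on_\<kk>) (simp add: D_bracket D0 matrix_bilinear_simps)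
  qed
  then have "killing_form G X X = 0" by (simp add: killing_form_def operator_trace_def)
  then show False using cartan_props(6)[OF X \<open>X \<noteq> 0\<close>] by simp
qed

lemma D_inject: "D X = D Y \<longleftrightarrow> X = Y"
  using D_eq_0[of "X - Y"] by (auto simp: D_simps)

text \<open>Since \<open>D\<close> is injective, every identity between brackets and adjoint actions can be checked on
  matrices.\<close>

lemma bracket_simps:
  "bracket (X + Y) W = bracket X W + bracket Y W" "bracket W (X + Y) = bracket W X + bracket W Y"
  "bracket (c *\<^sub>R X) W = c *\<^sub>R bracket X W" "bracket W (c *\<^sub>R X) = c *\<^sub>R bracket W X"
  by (simp_all flip: D_inject add: D_bracket D_simps matrix_bilinear_simps algebra_simps)

lemma bracket_flip: "bracket X Y = - bracket Y X"
  by (simp flip: D_inject add: D_bracket D_simps)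

lemma bracket_self: "bracket X X = 0"
  by (simp flip: D_inject add: D_bracket D_simps)

lemma bracket_eq_0_iff: "bracket X Y = 0 \<longleftrightarrow> D X ** D Y = D Y ** D X"
  by (simp flip: D_inject add: D_bracket D_simps)

lemma bracket_commute_ops:
  assumes "bracket X Y = 0"
  shows "bracket X (bracket Y W) = bracket Y (bracket X W)"
proof -
  have "D X ** D Y = D Y ** D X" using assms by (simp add: bracket_eq_0_iff)
  then have "D X ** D Y ** D W = D Y ** D X ** D W" "D W ** D X ** D Y = D W ** D Y ** D X"
    by (simp_all flip: matrix_mul_assoc)
  then show ?thesis
    by (simp flip: D_inject add: D_bracket matrix_bilinear_simps matrix_mul_assoc algebra_simps)
qed

lemma linear_bracket: "linear (bracket X)"
  by (intro linearI) (simp_all add: bracket_simps)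

lemma Ad_mult: "x \<in> carrier G \<Longrightarrow> y \<in> carrier G \<Longrightarrow> Ad G (x \<otimes> y) X = Ad G x (Ad G y X)"
  by (simp flip: D_inject add: D_Ad \<rho>_mult inv_mult_group matrix_mul_assoc)

lemma Ad_one: "Ad G \<one> X = X"
  by (simp flip: D_inject add: D_Ad \<rho>_one)

lemma Ad_inv: "g \<in> carrier G \<Longrightarrow> Ad G (inv g) (Ad G g X) = X"
  "g \<in> carrier G \<Longrightarrow> Ad G g (Ad G (inv g) X) = X"
  by (simp_all flip: Ad_mult add: Ad_one)

lemma Ad_bracket:
  assumes "g \<in> carrier G"
  shows "Ad G g (bracket X Y) = bracket (Ad G g X) (Ad G g Y)"
proof -
  have "D (Ad G g A) ** D (Ad G g B) = \<rho> g ** (D A ** D B) ** \<rho> (inv g)" for A B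
  proof -
    have "\<rho> (inv g) ** (\<rho> g ** Y) = Y" for Y :: "complex^'n^'n"
      using assms by (simp add: matrix_mul_assoc \<rho>_inv)
    then show ?thesis using assms by (simp add: D_Ad flip: matrix_mul_assoc)
  qed
  then show ?thesis
    using assms by (simp flip: D_inject add: D_bracket D_Ad[of _ "bracket X Y"] matrix_bilinear_simps)
qed

text \<open>Conjugation by a unitary matrix keeps \<open>D X\<close> Hermitian, and the Hermitian elements of the image of
  \<open>D\<close> come from \<open>\<pp>\<close>.\<close>

lemma Ad_\<pp>:
  assumes k: "k \<in> K" and X: "X \<in> \<pp>"
  shows "Ad G k X \<in> \<pp>"
proof -
  note kc = K_closed(1)[OF k] K_closed(2)[OF k]
  obtain Z P where ZP: "Z \<in> \<kk>" "P \<in> \<pp>" "Ad G k X = Z + P" by (rule cartan_split)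
  have "conj_transpose (D (Ad G k X)) = D (Ad G k X)"
    using kc k by (simp add: D_Ad conj_transpose_mult conj_transpose_\<rho> conj_transpose_D_\<pp>[OF X]
        matrix_mul_assoc)
  then have "conj_transpose (D Z + D P) = D Z + D P" by (simp add: ZP(3) D_simps)
  then have "- D Z + D P = D Z + D P"
    using ZP by (simp add: linear_add[OF linear_conj_transpose] conj_transpose_D_\<kk> conj_transpose_D_\<pp>)
  then have "2 *\<^sub>R D Z = 0" by (simp add: scaleR_2 eq_neg_iff_add_eq_0)
  then have "Z = 0" using D_eq_0 by simp
  then show ?thesis using ZP by simp
qed

lemma inner_bracket_\<pp>:
  "H \<in> \<pp> \<Longrightarrow> D (bracket H X) \<bullet> D Y = D X \<bullet> D (bracket H Y)"
  by (simp add: D_bracket inner_diff_left inner_diff_right inner_matrix_mult_left[of "D H"]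
      inner_matrix_mult_right[of _ "D H"] conj_transpose_D_\<pp>)

lemma inner_bracket_\<kk>:
  "Z \<in> \<kk> \<Longrightarrow> D (bracket Z X) \<bullet> D Y = - (D X \<bullet> D (bracket Z Y))"
  by (simp add: D_bracket inner_diff_left inner_diff_right inner_matrix_mult_left[of "D Z"]
      inner_matrix_mult_right[of _ "D Z"] conj_transpose_D_\<kk> matrix_bilinear_simps)

end

section \<open>Common eigenvectors of commuting symmetric operators\<close>

text \<open>The polynomial is a nonnegative form along a line \<open>x + t v\<close> whose base point \<open>x\<close> it annihilates;
  the conclusion is that \<open>x\<close> is orthogonal to \<open>v\<close> for the form.\<close>

lemma linear_term_zero_of_nonneg:
  fixes r s :: real
  assumes "\<And>t. 2 * t * r + t\<^sup>2 * s \<ge> 0" "s \<ge> 0"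
  shows "r = 0"
proof (rule ccontr)
  assume "r \<noteq> 0"
  \<comment> \<open>close to the minimiser \<open>- r / s\<close>, and defined for \<open>s = 0\<close> too\<close>
  define t where "t = - r / (s + 1)"
  have ts: "t * (s + 1) = - r" using assms(2) by (simp add: t_def)
  then have "t \<noteq> 0" using \<open>r \<noteq> 0\<close> by auto
  have r: "r = - (t * (s + 1))" using ts by simp
  have "2 * t * r + t\<^sup>2 * s = - (t\<^sup>2 * (s + 2))"
    by (subst r) (simp add: power2_eq_square algebra_simps)
  moreover have "t\<^sup>2 * (s + 2) > 0" using \<open>t \<noteq> 0\<close> assms(2) by (intro mult_pos_pos) auto
  ultimately show False using assms(1)[of t] by linarith
qed

text \<open>Symmetry refers to the inner product pulled back along an injective linear map \<open>D\<close>.  The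
  eigenvector maximises the Rayleigh quotient: at a maximiser the nonnegative form \<open>c Q - Q(f \<cdot>, \<cdot>)\<close>
  vanishes, so its radical contains the maximiser.\<close>

lemma symmetric_operator_eigenvector:
  fixes D :: "'e::euclidean_space \<Rightarrow> 'v::euclidean_space"
  assumes D: "linear D" "\<And>x. D x = 0 \<Longrightarrow> x = 0"
    and f: "linear f" "\<And>x y. D (f x) \<bullet> D y = D x \<bullet> D (f y)"
    and W: "subspace W" "W \<noteq> {0}" "\<And>x. x \<in> W \<Longrightarrow> f x \<in> W"
  obtains x c where "x \<in> W" "x \<noteq> 0" "f x = c *\<^sub>R x"
proof -
  note Ds = linear_add[OF D(1)] linear_cmul[OF D(1)] linear_diff[OF D(1)]
  note fs = linear_add[OF f(1)] linear_cmul[OF f(1)] linear_diff[OF f(1)]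
  have Dpos: "D x \<bullet> D x > 0" if "x \<noteq> 0" for x using D(2) that by auto
  define q where "q x = (D (f x) \<bullet> D x) / (D x \<bullet> D x)" for x
  have "0 \<in> W" using W(1) by (rule subspace_0)
  then obtain w where w: "w \<in> W" "w \<noteq> 0" using W(2) by blast
  have "compact (W \<inter> sphere 0 1)"
    using closed_subspace[OF W(1)] by (simp add: closed_Int_compact)
  moreover have "(1 / norm w) *\<^sub>R w \<in> W \<inter> sphere 0 1"
    using w W(1) by (simp add: subspace_scale)
  then have "W \<inter> sphere 0 1 \<noteq> {}" by blast
  moreover have "continuous_on (W \<inter> sphere 0 1) q"
  proof -
    have "continuous_on (W \<inter> sphere 0 1) D" "continuous_on (W \<inter> sphere 0 1) (\<lambda>x. D (f x))"
      using D(1) linear_compose[OF f(1) D(1)]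
      by (simp_all add: linear_continuous_on linear_conv_bounded_linear comp_def)
    moreover have "D x \<bullet> D x \<noteq> 0" if "x \<in> W \<inter> sphere 0 1" for x
      using Dpos[of x] that by (cases "x = 0") auto
    ultimately show ?thesis unfolding q_def by (intro continuous_intros) auto
  qed
  ultimately obtain x where xS: "x \<in> W \<inter> sphere 0 1" "\<forall>y\<in>W \<inter> sphere 0 1. q y \<le> q x"
    using continuous_attains_sup[of "W \<inter> sphere 0 1" q] by blast
  have x: "x \<in> W" "norm x = 1" using xS(1) by auto
  have max: "q y \<le> q x" if "y \<in> W" "norm y = 1" for y using xS(2) that by auto
  have x0: "x \<noteq> 0" using x(2) by auto
  define c where "c = q x"
  have cx: "c * (D x \<bullet> D x) = D (f x) \<bullet> D x"
    using Dpos[OF x0] by (simp add: c_def q_def)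
  have le: "D (f y) \<bullet> D y \<le> c * (D y \<bullet> D y)" if y: "y \<in> W" for y
  proof (cases "y = 0")
    case False
    let ?z = "(1 / norm y) *\<^sub>R y"
    have "q ?z \<le> c"
      unfolding c_def using y False W(1) by (intro max) (simp_all add: subspace_scale)
    moreover have "q ?z = q y" using False by (simp add: q_def Ds fs)
    ultimately have "q y \<le> c" by (simp only:)
    then show ?thesis using Dpos[OF False] by (simp add: q_def pos_divide_le_eq del: inner_gt_zero_iff)
  qed (simp add: linear_0[OF D(1)])
  define v where "v = c *\<^sub>R x - f x"
  have v: "v \<in> W" using x W by (simp add: v_def subspace_diff subspace_scale)
  have "D v \<bullet> D v = 0"
  proof (rule linear_term_zero_of_nonneg)
    show "0 \<le> c * (D v \<bullet> D v) - D (f v) \<bullet> D v" using le[OF v] by simp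
    fix t
    have "x + t *\<^sub>R v \<in> W" using x v W(1) by (simp add: subspace_add subspace_scale)
    note le[OF this]
    moreover have "D (x + t *\<^sub>R v) \<bullet> D (x + t *\<^sub>R v) =
        D x \<bullet> D x + 2 * t * (D x \<bullet> D v) + t\<^sup>2 * (D v \<bullet> D v)"
      using inner_commute[of "D v" "D x"]
      by (simp add: Ds inner_add_left inner_add_right power2_eq_square distrib_left)
    moreover have "D (f v) \<bullet> D x = D (f x) \<bullet> D v"
      using f(2)[of v x] by (simp add: inner_commute)
    then have "D (f (x + t *\<^sub>R v)) \<bullet> D (x + t *\<^sub>R v) =
        D (f x) \<bullet> D x + 2 * t * (D (f x) \<bullet> D v) + t\<^sup>2 * (D (f v) \<bullet> D v)"
      by (simp add: Ds fs inner_add_left inner_add_right power2_eq_square distrib_left)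
    ultimately have "0 \<le> c * (D x \<bullet> D x) - D (f x) \<bullet> D x + 2 * t * (c * (D x \<bullet> D v) - D (f x) \<bullet> D v)
        + t\<^sup>2 * (c * (D v \<bullet> D v) - D (f v) \<bullet> D v)"
      by (simp add: algebra_simps)
    moreover have "c * (D x \<bullet> D v) - D (f x) \<bullet> D v = D v \<bullet> D v"
      by (simp add: v_def Ds inner_diff_left)
    ultimately show "0 \<le> 2 * t * (D v \<bullet> D v) + t\<^sup>2 * (c * (D v \<bullet> D v) - D (f v) \<bullet> D v)"
      using cx by simp
  qed
  then have "v = 0" using D(2) by simp
  then show ?thesis using that[of x c] x x0 by (simp add: v_def)
qed

text \<open>On an invariant subspace of minimal positive dimension every operator of the family is a
  scalar, because its eigenspaces are invariant.\<close>

lemma commuting_symmetric_common_eigenvector: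
  fixes D :: "'e::euclidean_space \<Rightarrow> 'v::euclidean_space" and F :: "('e \<Rightarrow> 'e) set"
  assumes D: "linear D" "\<And>x. D x = 0 \<Longrightarrow> x = 0"
    and lin: "\<And>f. f \<in> F \<Longrightarrow> linear f"
    and sym: "\<And>f x y. f \<in> F \<Longrightarrow> D (f x) \<bullet> D y = D x \<bullet> D (f y)"
    and comm: "\<And>f g x. f \<in> F \<Longrightarrow> g \<in> F \<Longrightarrow> f (g x) = g (f x)"
    and W: "subspace W" "W \<noteq> {0}" "\<And>f x. f \<in> F \<Longrightarrow> x \<in> W \<Longrightarrow> f x \<in> W"
  obtains x where "x \<in> W" "x \<noteq> 0" "\<forall>f\<in>F. \<exists>c. f x = c *\<^sub>R x"
proof -
  define P where "P U \<longleftrightarrow> subspace U \<and> U \<noteq> {0} \<and> U \<subseteq> W \<and> (\<forall>f\<in>F. \<forall>x\<in>U. f x \<in> U)" for U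
  have "P W" using W by (auto simp: P_def)
  then obtain U where U: "P U" and min: "\<And>U'. P U' \<Longrightarrow> dim U \<le> dim U'"
    using ex_has_least_nat[of P W dim] by blast
  have scalar: "\<exists>c. \<forall>u\<in>U. f u = c *\<^sub>R u" if f: "f \<in> F" for f
  proof -
    obtain x c where x: "x \<in> U" "x \<noteq> 0" "f x = c *\<^sub>R x"
      using symmetric_operator_eigenvector[OF D lin[OF f] sym[OF f], of U] U f
      unfolding P_def by metis
    define U' where "U' = {u \<in> U. f u = c *\<^sub>R u}"
    have "subspace U'"
      using U unfolding P_def U'_def subspace_def
      by (auto simp: linear_0[OF lin[OF f]] linear_add[OF lin[OF f]] linear_cmul[OF lin[OF f]]
          scaleR_add_right scaleR_left_commute)
    moreover have "g u \<in> U'" if "g \<in> F" "u \<in> U'" for g u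
      using that U comm[OF f that(1), of u] by (auto simp: U'_def P_def linear_cmul[OF lin[OF that(1)]])
    moreover have "x \<in> U'" using x by (simp add: U'_def)
    ultimately have "P U'" using U x(2) unfolding P_def by (auto simp: U'_def)
    then have "U' = U"
      using min[of U'] U by (intro subspace_dim_equal) (auto simp: P_def U'_def)
    then show ?thesis unfolding U'_def by blast
  qed
  have "0 \<in> U" "U \<noteq> {0}" using U subspace_0 by (auto simp: P_def)
  then obtain x where x: "x \<in> U" "x \<noteq> 0" by blast
  have "\<exists>c. f x = c *\<^sub>R x" if "f \<in> F" for f using scalar[OF that] x(1) by blast
  moreover have "x \<in> W" using U x(1) by (auto simp: P_def)
  ultimately show ?thesis using that[of x] x(2) by blast
qed

section \<open>Restricted roots and regular elements\<close>

locale compatible_representation_with_torus = compatible_representation G \<tau> K \<pp> h T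
  for G :: "('g, 'e::euclidean_space) lie_group_data" (structure)
    and \<tau> :: "'g \<Rightarrow> complex^'n^'n" and K \<pp> h T +
  fixes \<aa> :: "'e set"
  assumes max_abelian: "maximal_abelian_subalgebra_in G \<pp> \<aa>"
begin

abbreviation roots :: "('e \<Rightarrow> real) set" where "roots \<equiv> restricted_roots G \<aa>"

lemma \<aa>_props: "subspace \<aa>" "\<aa> \<subseteq> \<pp>" "H \<in> \<aa> \<Longrightarrow> H' \<in> \<aa> \<Longrightarrow> bracket H H' = 0"
  using max_abelian by (auto simp: maximal_abelian_subalgebra_in_def abelian_subalgebra_in_def)

text \<open>Otherwise \<open>\<aa> + \<real> X\<close> would be a larger Abelian subalgebra.\<close>

lemma centralizer_of_\<aa>:
  assumes X: "X \<in> \<pp>" and comm: "\<And>H. H \<in> \<aa> \<Longrightarrow> bracket H X = 0"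
  shows "X \<in> \<aa>"
proof -
  define \<bb> where "\<bb> = {H + t *\<^sub>R X | H t. H \<in> \<aa>}"
  have "\<bb> = {x + y | x y. x \<in> \<aa> \<and> y \<in> span {X}}"
    by (auto simp: \<bb>_def span_singleton)
  then have "subspace \<bb>" using subspace_sums[OF \<aa>_props(1) subspace_span] by simp
  moreover have "\<bb> \<subseteq> \<pp>"
    using \<aa>_props(2) X cartan_props(2) by (auto simp: \<bb>_def subspace_add subspace_scale)
  moreover have "bracket A B = 0" if "A \<in> \<bb>" "B \<in> \<bb>" for A B
  proof -
    obtain H t H' t' where AB: "A = H + t *\<^sub>R X" "B = H' + t' *\<^sub>R X" "H \<in> \<aa>" "H' \<in> \<aa>"
      using \<open>A \<in> \<bb>\<close> \<open>B \<in> \<bb>\<close> unfolding \<bb>_def by blast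
    have "bracket X H' = 0" using comm[OF AB(4)] bracket_flip[of X H'] by simp
    then show ?thesis using AB comm \<aa>_props(3) by (simp add: bracket_simps bracket_self)
  qed
  moreover have "\<aa> \<subseteq> \<bb>" unfolding \<bb>_def by (force intro: exI[of _ 0])
  ultimately have "\<bb> = \<aa>"
    using max_abelian unfolding maximal_abelian_subalgebra_in_def abelian_subalgebra_in_def by blast
  moreover have "X \<in> \<bb>"
    unfolding \<bb>_def using subspace_0[OF \<aa>_props(1)] by (force intro: exI[of _ 1])
  ultimately show ?thesis by simp
qed

text \<open>If \<open>[\<aa>, ker (ad Y)]\<close> were nonzero, it would contain a root vector by the previous section,
  and the root would vanish at \<open>Y\<close>.\<close>

lemma centralizer_of_regular:
  assumes Y: "Y \<in> \<aa>" and regular: "\<forall>\<alpha>\<in>roots. \<alpha> Y \<noteq> 0"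
    and X: "X \<in> \<pp>" "bracket Y X = 0"
  shows "X \<in> \<aa>"
proof (rule ccontr)
  assume "X \<notin> \<aa>"
  then obtain H0 where H0: "H0 \<in> \<aa>" "bracket H0 X \<noteq> 0" using centralizer_of_\<aa>[OF X(1)] by blast
  define W where "W = bracket H0 ` {V. bracket Y V = 0}"
  have W1: "subspace W"
    unfolding W_def using linear_subspace_kernel[OF linear_bracket[of Y]] linear_bracket[of H0]
    by (intro linear_subspace_image)
  have "bracket H0 X \<in> W" using X(2) by (auto simp: W_def)
  then have W2: "W \<noteq> {0}" using H0(2) by auto
  have W3: "f x \<in> W" if f: "f \<in> bracket ` \<aa>" and x: "x \<in> W" for f x
  proof -
    obtain H V where HV: "H \<in> \<aa>" "f = bracket H" "bracket Y V = 0" "x = bracket H0 V"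
      using f x by (auto simp: W_def)
    have "f x = bracket H0 (bracket H V)"
      using HV bracket_commute_ops[OF \<aa>_props(3)[OF HV(1) H0(1)]] by simp
    moreover have "bracket Y (bracket H V) = 0"
      using HV(3) bracket_commute_ops[OF \<aa>_props(3)[OF Y HV(1)], of V] linear_0[OF linear_bracket]
      by simp
    ultimately show ?thesis by (auto simp: W_def)
  qed
  obtain x where x: "x \<in> W" "x \<noteq> 0" "\<forall>f\<in>bracket ` \<aa>. \<exists>c. f x = c *\<^sub>R x"
  proof (rule commuting_symmetric_common_eigenvector[where D = D and F = "bracket ` \<aa>" and W = W,
        OF linear_D D_eq_0 _ _ _ W1 W2])
    fix f g x y
    assume f: "f \<in> bracket ` \<aa>"
    then show "linear f" "D (f x) \<bullet> D y = D x \<bullet> D (f y)"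
      using linear_bracket \<aa>_props(2) inner_bracket_\<pp> by blast+
    show "x \<in> W \<Longrightarrow> f x \<in> W" using W3[OF f] .
    assume "g \<in> bracket ` \<aa>"
    then show "f (g x) = g (f x)" using f bracket_commute_ops \<aa>_props(3) by auto
  qed (assumption | rule that)+
  then have "\<forall>H\<in>\<aa>. \<exists>c. bracket H x = c *\<^sub>R x" by blast
  then obtain \<beta> where \<beta>: "\<And>H. H \<in> \<aa> \<Longrightarrow> bracket H x = \<beta> H *\<^sub>R x" by metis
  define \<alpha> where "\<alpha> H = (if H \<in> \<aa> then \<beta> H else 0)" for H
  have \<alpha>: "bracket H x = \<alpha> H *\<^sub>R x" if "H \<in> \<aa>" for H using \<beta>[OF that] that by (simp add: \<alpha>_def)
  have eq: "a = b" if "a *\<^sub>R x = b *\<^sub>R x" for a b using that x(2) by simp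
  have "\<alpha> \<in> dual_space \<aa>"
    unfolding dual_space_def
  proof (clarsimp, intro conjI ballI allI impI)
    fix H H' c assume H: "H \<in> \<aa>"
    show "\<alpha> (c *\<^sub>R H) = c * \<alpha> H"
      using \<alpha>[of "c *\<^sub>R H"] \<alpha>[OF H] H subspace_scale[OF \<aa>_props(1)]
      by (intro eq) (metis bracket_simps(3) scaleR_scaleR)
    assume H': "H' \<in> \<aa>"
    show "\<alpha> (H + H') = \<alpha> H + \<alpha> H'"
      using \<alpha>[of "H + H'"] \<alpha>[OF H] \<alpha>[OF H'] H H' subspace_add[OF \<aa>_props(1)]
      by (intro eq) (metis bracket_simps(1) scaleR_add_left)
  qed (simp add: \<alpha>_def)
  moreover have "\<alpha> H0 \<noteq> 0"
  proof
    assume 0: "\<alpha> H0 = 0"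
    obtain V where V: "x = bracket H0 V" using x(1) by (auto simp: W_def)
    have "bracket H0 x = 0" using \<alpha>[OF H0(1)] 0 by simp
    then have "D (bracket H0 V) \<bullet> D x = 0"
      using H0(1) \<aa>_props(2) inner_bracket_\<pp>[of H0 V x] by (auto simp: D_simps)
    then show False using x(2) D_eq_0 by (simp add: V)
  qed
  then have "\<alpha> \<noteq> 0" by auto
  moreover have "x \<in> restricted_root_space G \<aa> \<alpha>" using \<alpha> by (simp add: restricted_root_space_def)
  then have "restricted_root_space G \<aa> \<alpha> \<noteq> {0}" using x(2) by auto
  ultimately have "\<alpha> \<in> roots" by (simp add: restricted_roots_def)
  moreover have "bracket Y x = 0"
  proof -
    obtain V where V: "x = bracket H0 V" "bracket Y V = 0" using x(1) by (auto simp: W_def)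
    then show ?thesis
      using bracket_commute_ops[OF \<aa>_props(3)[OF Y H0(1)], of V] linear_0[OF linear_bracket] by simp
  qed
  then have "\<alpha> Y = 0" using \<alpha>[OF Y] x(2) by simp
  ultimately show False using regular by blast
qed

text \<open>Root vectors of different roots are orthogonal, because \<open>ad H\<close> is symmetric for \<open>H \<in> \<aa>\<close>.\<close>

lemma finite_roots: "finite roots"
proof -
  have "\<exists>x. \<alpha> \<in> roots \<longrightarrow> x \<noteq> 0 \<and> (\<forall>H\<in>\<aa>. bracket H x = \<alpha> H *\<^sub>R x)" for \<alpha>
  proof (cases "\<alpha> \<in> roots")
    case True
    then have "restricted_root_space G \<aa> \<alpha> \<noteq> {0}" "0 \<in> restricted_root_space G \<aa> \<alpha>"
      by (simp_all add: restricted_roots_def restricted_root_space_def linear_0[OF linear_bracket])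
    then show ?thesis by (auto simp: restricted_root_space_def)
  qed simp
  then obtain v where v: "\<And>\<alpha>. \<alpha> \<in> roots \<Longrightarrow> v \<alpha> \<noteq> 0"
    "\<And>\<alpha> H. \<alpha> \<in> roots \<Longrightarrow> H \<in> \<aa> \<Longrightarrow> bracket H (v \<alpha>) = \<alpha> H *\<^sub>R v \<alpha>" by metis
  have orth: "D (v \<alpha>) \<bullet> D (v \<beta>) = 0" if ab: "\<alpha> \<in> roots" "\<beta> \<in> roots" "\<alpha> \<noteq> \<beta>" for \<alpha> \<beta>
  proof -
    obtain H where H: "\<alpha> H \<noteq> \<beta> H" using ab(3) by blast
    have off: "\<nu> H = 0" if "\<nu> \<in> roots" "H \<notin> \<aa>" for \<nu>
      using that by (simp add: restricted_roots_def dual_space_def)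
    then have "H \<in> \<aa>" using H ab by metis
    then have "\<alpha> H * (D (v \<alpha>) \<bullet> D (v \<beta>)) = \<beta> H * (D (v \<alpha>) \<bullet> D (v \<beta>))"
      using inner_bracket_\<pp>[of H "v \<alpha>" "v \<beta>"] \<aa>_props(2) ab v(2) by (auto simp: D_simps)
    then show ?thesis using H by simp
  qed
  have nz: "D (v \<alpha>) \<noteq> 0" if "\<alpha> \<in> roots" for \<alpha> using v(1)[OF that] D_eq_0 by blast
  have "pairwise orthogonal ((\<lambda>\<alpha>. D (v \<alpha>)) ` roots)"
    using orth by (auto simp: pairwise_def orthogonal_def)
  then have "independent ((\<lambda>\<alpha>. D (v \<alpha>)) ` roots)"
    by (rule pairwise_orthogonal_independent) (use nz in force)
  then have "finite ((\<lambda>\<alpha>. D (v \<alpha>)) ` roots)" by (rule independent_imp_finite)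
  moreover have "inj_on (\<lambda>\<alpha>. D (v \<alpha>)) roots"
    using orth nz by (intro inj_onI) (metis inner_eq_zero_iff)
  ultimately show ?thesis by (rule finite_imageD)
qed

end

section \<open>Maximising over the compact group\<close>

lemma second_derivative_nonpos_at_max:
  fixes f f' :: "real \<Rightarrow> real"
  assumes f: "\<And>t. (f has_real_derivative f' t) (at t)"
    and f': "(f' has_real_derivative c) (at 0)" and max: "\<And>t. f t \<le> f 0"
  shows "f' 0 = 0" "c \<le> 0"
proof -
  show 0: "f' 0 = 0" using DERIV_local_max[OF f[of 0], of 1] max by simp
  show "c \<le> 0"
  proof (rule ccontr)
    assume "\<not> c \<le> 0"
    then obtain d where d: "d > 0" "\<And>t. 0 < t \<Longrightarrow> t < d \<Longrightarrow> 0 < f' t"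
      using DERIV_pos_inc_right[OF f'] 0 by auto
    obtain z where z: "0 < z" "z < d / 2" "f (d / 2) - f 0 = (d / 2 - 0) * f' z"
      using MVT2[of 0 "d / 2" f f'] f d(1) by auto
    have "(d / 2 - 0) * f' z > 0" using z d by simp
    then show False using z(3) max[of "d / 2"] by linarith
  qed
qed

context compatible_representation
begin

lemma D_one_parameter_orbit_derivative:
  assumes \<gamma>: "\<And>t. \<gamma> t \<in> K"
    "\<And>t. ((\<lambda>t. \<rho> (\<gamma> t)) has_vector_derivative \<rho> (\<gamma> t) ** D Z) (at t)"
    and Z: "Z \<in> \<kk>"
  shows "((\<lambda>t. D (Ad G (\<gamma> t) A) \<bullet> M) has_real_derivative D (Ad G (\<gamma> t) (bracket Z A)) \<bullet> M) (at t)"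
proof -
  have bl: "bounded_linear (conj_transpose :: complex^'n^'n \<Rightarrow> _)"
    using linear_conj_transpose by (simp add: linear_conv_bounded_linear)
  have 1: "((\<lambda>t. \<rho> (inv (\<gamma> t))) has_vector_derivative - (D Z ** \<rho> (inv (\<gamma> t)))) (at t)"
    using bounded_linear.has_vector_derivative[OF bl \<gamma>(2)[of t]]
    by (simp add: conj_transpose_mult conj_transpose_\<rho>[OF \<gamma>(1)] conj_transpose_D_\<kk>[OF Z]
        matrix_bilinear_simps)
  have 2: "((\<lambda>t. \<rho> (\<gamma> t) ** D A) has_vector_derivative \<rho> (\<gamma> t) ** D Z ** D A) (at t)"
    by (rule bounded_linear.has_vector_derivative[OF
        bounded_bilinear.bounded_linear_left[OF bounded_bilinear_matrix_mult] \<gamma>(2)])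
  have "((\<lambda>t. \<rho> (\<gamma> t) ** D A ** \<rho> (inv (\<gamma> t))) has_vector_derivative
      (\<rho> (\<gamma> t) ** D A) ** (- (D Z ** \<rho> (inv (\<gamma> t)))) + (\<rho> (\<gamma> t) ** D Z ** D A) ** \<rho> (inv (\<gamma> t))) (at t)"
    by (rule bounded_bilinear.has_vector_derivative[OF bounded_bilinear_matrix_mult 2 1])
  then have "((\<lambda>t. D (Ad G (\<gamma> t) A)) has_vector_derivative D (Ad G (\<gamma> t) (bracket Z A))) (at t)"
    by (simp add: D_Ad K_closed(1)[OF \<gamma>(1)] D_bracket matrix_bilinear_simps matrix_mul_assoc)
  from bounded_linear.has_vector_derivative[OF bounded_linear_inner_left this]
  show ?thesis by (simp add: has_real_derivative_iff_has_vector_derivative)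
qed

text \<open>The maximum is taken over the compact set \<open>\<tau> ` K\<close> of matrices, on which the function is
  visibly continuous.\<close>

lemma orbit_attains_max:
  obtains k where "k \<in> K" "\<forall>l\<in>K. D (Ad G l X) \<bullet> M \<le> D (Ad G k X) \<bullet> M"
proof -
  define c where "c A = matrix_inv T ** A ** T" for A
  define q where "q A = (c A ** D X ** conj_transpose (c A)) \<bullet> M" for A
  have blc: "bounded_linear c"
    unfolding c_def using linear_matrix_mult_left by (simp add: linear_conv_bounded_linear)
  have blt: "bounded_linear (conj_transpose :: complex^'n^'n \<Rightarrow> _)"
    using linear_conj_transpose by (simp add: linear_conv_bounded_linear)
  have "continuous_on (\<tau> ` K) q"
    unfolding q_def
    by (intro continuous_on_inner bounded_bilinear.continuous_on[OF bounded_bilinear_matrix_mult]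
        continuous_on_const bounded_linear.continuous_on[OF blt] bounded_linear.continuous_on[OF blc]
        continuous_on_id)
  moreover have "compact (\<tau> ` K)"
    using image_compactin[OF compact_K continuous_rep] by simp
  moreover have "\<tau> ` K \<noteq> {}" using subgroup.one_closed[OF subgroup_K] by blast
  ultimately obtain k where k: "k \<in> K" "\<forall>l\<in>K. q (\<tau> l) \<le> q (\<tau> k)"
    using continuous_attains_sup[of "\<tau> ` K" q] by auto
  have "q (\<tau> l) = D (Ad G l X) \<bullet> M" if "l \<in> K" for l
    using that by (simp add: q_def c_def D_Ad K_closed(1) flip: conj_transpose_\<rho>) (simp add: \<rho>_def)
  then show ?thesis using that k by metis
qed

text \<open>The first derivative of \<open>t \<mapsto> \<langle>Ad (exp (t Z) k) X, Y\<rangle>\<close> vanishes at the maximiser \<open>k\<close>; for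
  \<open>Z = [Ad k X, Y]\<close> it equals \<open>- \<parallel>Z\<parallel>\<^sup>2\<close>.\<close>

lemma exists_commuting_conjugate:
  assumes X: "X \<in> \<pp>" and Y: "Y \<in> \<pp>"
  obtains k where "k \<in> K" "bracket Y (Ad G k X) = 0"
    "\<And>Z. Z \<in> \<kk> \<Longrightarrow> D (bracket Z (bracket Z (Ad G k X))) \<bullet> D Y \<le> 0"
proof -
  obtain k where k: "k \<in> K" and max: "\<forall>l\<in>K. D (Ad G l X) \<bullet> D Y \<le> D (Ad G k X) \<bullet> D Y"
    by (rule orbit_attains_max)
  define A where "A = Ad G k X"
  have A: "A \<in> \<pp>" using Ad_\<pp>[OF k X] by (simp add: A_def)
  have *: "D (bracket Z A) \<bullet> D Y = 0" "D (bracket Z (bracket Z A)) \<bullet> D Y \<le> 0" if Z: "Z \<in> \<kk>" for Z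
  proof -
    obtain \<gamma> :: "real \<Rightarrow> 'g" where \<gamma>: "\<And>t. \<gamma> t \<in> K" "\<gamma> 0 = \<one>"
      "\<And>t. ((\<lambda>t. \<rho> (\<gamma> t)) has_vector_derivative \<rho> (\<gamma> t) ** D Z) (at t)"
      by (rule one_parameter_subgroup_\<rho>[OF Z]) blast
    note der = D_one_parameter_orbit_derivative[OF \<gamma>(1,3) Z, where M = "D Y"]
    have "D (Ad G (\<gamma> t) A) \<bullet> D Y \<le> D (Ad G (\<gamma> 0) A) \<bullet> D Y" for t
      using bspec[OF max, of "\<gamma> t \<otimes> k"] \<gamma>(1) k subgroup.m_closed[OF subgroup_K]
      by (simp add: A_def \<gamma>(2) Ad_mult Ad_one K_closed(1))
    from second_derivative_nonpos_at_max[OF der[of A] der[of "bracket Z A" 0] this]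
    show "D (bracket Z A) \<bullet> D Y = 0" "D (bracket Z (bracket Z A)) \<bullet> D Y \<le> 0"
      by (simp_all add: \<gamma>(2) Ad_one)
  qed
  have "bracket A Y \<in> \<kk>" using cartan_props(5)[OF A Y] .
  then have "D (bracket (bracket A Y) A) \<bullet> D Y = 0" by (rule *(1))
  then have "D (bracket A (bracket A Y)) \<bullet> D Y = 0"
    using bracket_flip[of "bracket A Y" A] by (simp add: D_simps)
  then have "bracket A Y = 0" using inner_bracket_\<pp>[OF A, of "bracket A Y" Y] D_eq_0 by simp
  then have "bracket Y A = 0" using bracket_flip[of Y A] by simp
  then show ?thesis using that[OF k] *(2) by (simp add: A_def)
qed

end

context compatible_representation_with_torus
begin

text \<open>Split a root vector as \<open>Z + P\<close> with \<open>Z \<in> \<kk>\<close> and \<open>P \<in> \<pp>\<close>.  Then \<open>[H, Z] = \<alpha>(H) P\<close> and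
  \<open>[H, P] = \<alpha>(H) Z\<close>, so the second derivative in the direction \<open>Z\<close> is
  \<open>- \<alpha>(A) \<alpha>(Y) \<parallel>P\<parallel>\<^sup>2\<close>.\<close>

lemma root_product_nonneg:
  assumes A: "A \<in> \<aa>" and Y: "Y \<in> \<aa>" and \<alpha>: "\<alpha> \<in> roots"
    and second: "\<And>Z. Z \<in> \<kk> \<Longrightarrow> D (bracket Z (bracket Z A)) \<bullet> D Y \<le> 0"
  shows "\<alpha> A * \<alpha> Y \<ge> 0"
proof -
  have "restricted_root_space G \<aa> \<alpha> \<noteq> {0}" using \<alpha> by (simp add: restricted_roots_def)
  moreover have "0 \<in> restricted_root_space G \<aa> \<alpha>"
    by (simp add: restricted_root_space_def linear_0[OF linear_bracket])
  ultimately obtain X where X: "X \<noteq> 0" "\<And>H. H \<in> \<aa> \<Longrightarrow> bracket H X = \<alpha> H *\<^sub>R X"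
    by (auto simp: restricted_root_space_def)
  obtain Z P where ZP: "Z \<in> \<kk>" "P \<in> \<pp>" "X = Z + P" by (rule cartan_split)
  have br: "bracket H Z = \<alpha> H *\<^sub>R P" "bracket H P = \<alpha> H *\<^sub>R Z" if H: "H \<in> \<aa>" for H
  proof -
    have Hp: "H \<in> \<pp>" using H \<aa>_props(2) by blast
    have "bracket H Z \<in> \<pp>"
      using cartan_props(4)[OF ZP(1) Hp] bracket_flip[of H Z] subspace_neg[OF cartan_props(2)] by simp
    moreover have "bracket H P \<in> \<kk>" using cartan_props(5)[OF Hp ZP(2)] .
    moreover have "\<alpha> H *\<^sub>R Z \<in> \<kk>" "\<alpha> H *\<^sub>R P \<in> \<pp>"
      using ZP cartan_props(1,2) by (auto simp: subspace_scale)
    moreover have "bracket H P + bracket H Z = \<alpha> H *\<^sub>R Z + \<alpha> H *\<^sub>R P"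
      using X(2)[OF H] by (simp add: ZP(3) bracket_simps scaleR_add_right add.commute)
    ultimately show "bracket H Z = \<alpha> H *\<^sub>R P" "bracket H P = \<alpha> H *\<^sub>R Z"
      using cartan_split_unique by blast+
  qed
  have "P \<noteq> 0"
  proof
    assume P: "P = 0"
    have "\<alpha> H = 0" for H
    proof (cases "H \<in> \<aa>")
      case True
      then show ?thesis using br(2)[OF True] X(1) by (simp add: P ZP(3) linear_0[OF linear_bracket])
    next
      case False
      then show ?thesis using \<alpha> by (simp add: restricted_roots_def dual_space_def)
    qed
    then show False using \<alpha> by (auto simp: restricted_roots_def)
  qed
  have "bracket Z A = (- \<alpha> A) *\<^sub>R P" using br(1)[OF A] bracket_flip[of Z A] by simp
  then have "D (bracket Z (bracket Z A)) \<bullet> D Y = - \<alpha> A * (D (bracket Z P) \<bullet> D Y)"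
    by (simp add: bracket_simps D_simps linear_neg[OF linear_bracket])
  also have "D (bracket Z P) \<bullet> D Y = - (D P \<bullet> D (bracket Z Y))"
    by (rule inner_bracket_\<kk>[OF ZP(1)])
  also have "bracket Z Y = (- \<alpha> Y) *\<^sub>R P" using br(1)[OF Y] bracket_flip[of Z Y] by simp
  finally have "D (bracket Z (bracket Z A)) \<bullet> D Y = - (\<alpha> A * \<alpha> Y * (D P \<bullet> D P))"
    by (simp add: D_simps)
  then have "\<alpha> A * \<alpha> Y * (D P \<bullet> D P) \<ge> 0" using second[OF ZP(1)] by simp
  moreover have "D P \<bullet> D P > 0" using \<open>P \<noteq> 0\<close> D_eq_0 by auto
  ultimately show ?thesis by (simp add: zero_le_mult_iff)
qed

text \<open>Regularity of \<open>H\<close> and \<open>Y\<close> makes \<open>\<aa>\<close> the centraliser of each of them in \<open>\<pp>\<close>; this is what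
  turns the maximising element of \<open>K\<close> into one that normalises \<open>\<aa>\<close>.\<close>

lemma regular_conjugate_to_chamber:
  assumes H: "H \<in> \<aa>" "\<forall>\<alpha>\<in>roots. \<alpha> H \<noteq> 0"
    and Y: "Y \<in> \<aa>" "\<forall>\<alpha>\<in>roots. \<alpha> Y \<noteq> 0"
  obtains k where "k \<in> normalizer_in G K \<aa>" "\<And>\<alpha>. \<alpha> \<in> roots \<Longrightarrow> \<alpha> (Ad G k H) * \<alpha> Y \<ge> 0"
proof -
  have p: "H \<in> \<pp>" "Y \<in> \<pp>" using H Y \<aa>_props(2) by auto
  obtain k where k: "k \<in> K" "bracket Y (Ad G k H) = 0"
    "\<And>Z. Z \<in> \<kk> \<Longrightarrow> D (bracket Z (bracket Z (Ad G k H))) \<bullet> D Y \<le> 0"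
    using exists_commuting_conjugate[OF p] by blast
  note kc = K_closed[OF k(1)]
  have A: "Ad G k H \<in> \<aa>"
    using centralizer_of_regular[OF Y Ad_\<pp>[OF k(1) p(1)] k(2)] .
  have inv_stable: "Ad G (inv k) B \<in> \<aa>" if B: "B \<in> \<aa>" for B
  proof (rule centralizer_of_regular[OF H])
    show "Ad G (inv k) B \<in> \<pp>" using Ad_\<pp>[OF kc(2)] B \<aa>_props(2) by blast
    have "bracket (Ad G (inv k) (Ad G k H)) (Ad G (inv k) B) = Ad G (inv k) (bracket (Ad G k H) B)"
      using kc(1) by (simp add: Ad_bracket)
    then show "bracket H (Ad G (inv k) B) = 0"
      using \<aa>_props(3)[OF A B] kc(1) by (simp add: Ad_inv linear_0[OF linear_Ad])
  qed
  have stable: "Ad G k B \<in> \<aa>" if B: "B \<in> \<aa>" for B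
  proof (rule centralizer_of_\<aa>)
    show "Ad G k B \<in> \<pp>" using Ad_\<pp>[OF k(1)] B \<aa>_props(2) by blast
    fix H' assume H': "H' \<in> \<aa>"
    have "bracket (Ad G k (Ad G (inv k) H')) (Ad G k B) = Ad G k (bracket (Ad G (inv k) H') B)"
      using kc(1) by (simp add: Ad_bracket)
    then show "bracket H' (Ad G k B) = 0"
      using \<aa>_props(3)[OF inv_stable[OF H'] B] kc(1) by (simp add: Ad_inv linear_0[OF linear_Ad])
  qed
  have "Ad G k ` \<aa> = \<aa>"
  proof
    show "\<aa> \<subseteq> Ad G k ` \<aa>" using inv_stable Ad_inv(2)[OF kc(1)] by (metis image_eqI subsetI)
  qed (use stable in blast)
  then have "k \<in> normalizer_in G K \<aa>" using k(1) by (simp add: normalizer_in_def)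
  then show ?thesis using that root_product_nonneg[OF A Y(1) _ k(3)] by blast
qed

end

section \<open>Weights and the Weyl group\<close>

context compatible_representation_with_torus
begin

abbreviation wts :: "('e \<Rightarrow> real) set" where "wts \<equiv> weights G \<aa> \<tau>"
abbreviation N :: "'g set" where "N \<equiv> normalizer_in G K \<aa>"

text \<open>For \<open>k\<close> in the normaliser this is the contragredient action \<open>k\<cdot>\<nu>\<close>; the value \<open>0\<close> off \<open>\<aa>\<close> is the
  normalisation of \<open>dual_space\<close>.\<close>

definition coadjoint :: "'g \<Rightarrow> ('e \<Rightarrow> real) \<Rightarrow> 'e \<Rightarrow> real" where
  "coadjoint k \<nu> = (\<lambda>H. if H \<in> \<aa> then \<nu> (Ad G (inv k) H) else 0)"

lemma dual_spaceD:
  assumes "\<nu> \<in> dual_space \<aa>"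
  shows "x \<in> \<aa> \<Longrightarrow> y \<in> \<aa> \<Longrightarrow> \<nu> (x + y) = \<nu> x + \<nu> y" "x \<in> \<aa> \<Longrightarrow> \<nu> (c *\<^sub>R x) = c * \<nu> x"
    "x \<notin> \<aa> \<Longrightarrow> \<nu> x = 0"
  using assms by (auto simp: dual_space_def)

lemma dual_space_sum:
  assumes \<nu>: "\<nu> \<in> dual_space \<aa>" and "\<And>b. b \<in> B \<Longrightarrow> b \<in> \<aa>"
  shows "\<nu> (\<Sum>b\<in>B. c b *\<^sub>R b) = (\<Sum>b\<in>B. c b * \<nu> b)"
  using assms(2)
proof (induction B rule: infinite_finite_induct)
  case (insert b B)
  have "(\<Sum>b\<in>B. c b *\<^sub>R b) \<in> \<aa>"
    using insert \<aa>_props(1) by (intro subspace_sum subspace_scale) auto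
  then show ?case
    using insert \<aa>_props(1) by (simp add: dual_spaceD[OF \<nu>] subspace_scale)
qed (use dual_spaceD(2)[OF \<nu> subspace_0[OF \<aa>_props(1)], of 0] in simp_all)

lemma weights_iff:
  "\<nu> \<in> wts \<longleftrightarrow> \<nu> \<in> dual_space \<aa> \<and>
     (\<exists>v. v \<noteq> 0 \<and> (\<forall>H\<in>\<aa>. d\<tau> H *v v = complex_of_real (\<nu> H) *s v))"
proof -
  have "0 \<in> weight_space G \<aa> \<tau> \<nu>" by (simp add: weight_space_def)
  then have "weight_space G \<aa> \<tau> \<nu> \<noteq> {0} \<longleftrightarrow> (\<exists>v. v \<noteq> 0 \<and> v \<in> weight_space G \<aa> \<tau> \<nu>)" by blast
  then show ?thesis by (simp add: weights_def weight_space_def)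
qed

text \<open>Weight vectors of different weights are orthogonal, because \<open>\<aa>\<close> acts by Hermitian matrices.\<close>

lemma finite_weights: "finite wts"
proof -
  have "\<exists>x. \<nu> \<in> wts \<longrightarrow> x \<noteq> 0 \<and> (\<forall>H\<in>\<aa>. D H *v x = \<nu> H *\<^sub>R x)" for \<nu>
  proof (cases "\<nu> \<in> wts")
    case True
    then obtain v where v: "v \<noteq> 0" "\<And>H. H \<in> \<aa> \<Longrightarrow> d\<tau> H *v v = complex_of_real (\<nu> H) *s v"
      unfolding weights_iff by blast
    define x where "x = matrix_inv T *v v"
    have Tx: "T *v x = v" by (simp add: x_def matrix_vector_mul_assoc T_inv)
    have "D H *v x = \<nu> H *\<^sub>R x" if "H \<in> \<aa>" for H
    proof -
      have d: "d\<tau> H *v v = \<nu> H *\<^sub>R v"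
        using v(2)[OF that] by (simp add: vec_eq_iff scaleR_conv_of_real[where 'a = complex])
      have "D H *v x = matrix_inv T *v (d\<tau> H *v (T *v x))"
        by (simp add: D_def matrix_vector_mul_assoc matrix_mul_assoc)
      also have "\<dots> = matrix_inv T *v (\<nu> H *\<^sub>R v)"
        by (simp add: Tx d)
      also have "\<dots> = \<nu> H *\<^sub>R x" by (simp add: x_def linear_cmul[OF matrix_vector_mul_linear])
      finally show ?thesis .
    qed
    moreover have "x \<noteq> 0" using v(1) Tx by auto
    ultimately show ?thesis by blast
  qed simp
  then obtain v where v: "\<And>\<nu>. \<nu> \<in> wts \<Longrightarrow> v \<nu> \<noteq> 0"
    "\<And>\<nu> H. \<nu> \<in> wts \<Longrightarrow> H \<in> \<aa> \<Longrightarrow> D H *v v \<nu> = \<nu> H *\<^sub>R v \<nu>" by metis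
  have orth: "v \<alpha> \<bullet> v \<beta> = 0" if ab: "\<alpha> \<in> wts" "\<beta> \<in> wts" "\<alpha> \<noteq> \<beta>" for \<alpha> \<beta>
  proof -
    obtain H where H: "\<alpha> H \<noteq> \<beta> H" using ab(3) by blast
    have "\<nu> H = 0" if "\<nu> \<in> wts" "H \<notin> \<aa>" for \<nu>
      using that dual_spaceD(3) by (simp add: weights_iff)
    then have Ha: "H \<in> \<aa>" using H ab by metis
    have "(D H *v v \<alpha>) \<bullet> v \<beta> = v \<alpha> \<bullet> (D H *v v \<beta>)"
      using Ha \<aa>_props(2) conj_transpose_D_\<pp>[of H] inner_matrix_vector_mult[of "D H" "v \<alpha>" "v \<beta>"]
      by auto
    then have "\<alpha> H * (v \<alpha> \<bullet> v \<beta>) = \<beta> H * (v \<alpha> \<bullet> v \<beta>)" by (simp add: v(2) ab Ha)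
    then show ?thesis using H by simp
  qed
  have "pairwise orthogonal (v ` wts)" using orth by (auto simp: pairwise_def orthogonal_def)
  then have "independent (v ` wts)"
    by (rule pairwise_orthogonal_independent) (use v(1) in force)
  then have "finite (v ` wts)" by (rule independent_imp_finite)
  moreover have "inj_on v wts" using orth v(1) by (intro inj_onI) (metis inner_eq_zero_iff)
  ultimately show ?thesis by (rule finite_imageD)
qed

lemma normalizer_props:
  assumes k: "k \<in> N"
  shows "k \<in> K" "k \<in> carrier G" "H \<in> \<aa> \<Longrightarrow> Ad G k H \<in> \<aa>" "H \<in> \<aa> \<Longrightarrow> Ad G (inv k) H \<in> \<aa>" "inv k \<in> N"
proof -
  show kK: "k \<in> K" using k by (simp add: normalizer_in_def)
  then show c: "k \<in> carrier G" by (rule K_closed)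
  have im: "Ad G k ` \<aa> = \<aa>" using k by (simp add: normalizer_in_def)
  show "H \<in> \<aa> \<Longrightarrow> Ad G k H \<in> \<aa>" for H using im by blast
  have "Ad G (inv k) ` \<aa> = Ad G (inv k) ` Ad G k ` \<aa>" using im by simp
  also have "\<dots> = \<aa>" by (simp add: image_image Ad_inv(1)[OF c])
  finally show "inv k \<in> N" using K_closed(2)[OF kK] by (simp add: normalizer_in_def)
  then show "H \<in> \<aa> \<Longrightarrow> Ad G (inv k) H \<in> \<aa>" for H unfolding normalizer_in_def by blast
qed

text \<open>\<open>\<tau> k\<close> carries weight vectors of \<open>\<nu>\<close> to weight vectors of \<open>k\<cdot>\<nu>\<close>.\<close>

lemma weights_invariant:
  assumes k: "k \<in> N" and \<nu>: "\<nu> \<in> wts"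
  shows "coadjoint k \<nu> \<in> wts"
proof -
  note kp = normalizer_props[OF k]
  have dual: "\<nu> \<in> dual_space \<aa>" using \<nu> by (simp add: weights_iff)
  obtain v where v: "v \<noteq> 0" "\<And>H. H \<in> \<aa> \<Longrightarrow> d\<tau> H *v v = complex_of_real (\<nu> H) *s v"
    using \<nu> unfolding weights_iff by blast
  have lin: "linear (Ad G (inv k))" using kp(2) by (simp add: linear_Ad)
  have "coadjoint k \<nu> \<in> dual_space \<aa>"
    using kp(4) \<aa>_props(1)
    by (simp add: dual_space_def coadjoint_def subspace_add subspace_scale
        linear_add[OF lin] linear_cmul[OF lin] dual_spaceD[OF dual])
  moreover have "d\<tau> H *v (\<tau> k *v v) = complex_of_real (coadjoint k \<nu> H) *s (\<tau> k *v v)"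
    if H: "H \<in> \<aa>" for H
  proof -
    let ?H = "Ad G (inv k) H"
    have "d\<tau> H = \<tau> k ** d\<tau> ?H ** \<tau> (inv k)"
      using d\<tau>_Ad[OF kp(2), of ?H] Ad_inv(2)[OF kp(2)] by simp
    then have "d\<tau> H *v (\<tau> k *v v) = \<tau> k *v (d\<tau> ?H *v v)"
      by (simp add: matrix_vector_mul_assoc rep_inv(2)[OF kp(2)] flip: matrix_mul_assoc)
    also have "\<dots> = complex_of_real (\<nu> ?H) *s (\<tau> k *v v)"
      using v(2)[OF kp(4)[OF H]] by (simp add: vector_scalar_commute)
    finally show ?thesis using H by (simp add: coadjoint_def)
  qed
  moreover have "\<tau> (inv k) *v (\<tau> k *v v) = v"
    using rep_inv(2)[OF kp(2)] by (simp add: matrix_vector_mul_assoc)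
  then have "\<tau> k *v v \<noteq> 0" using v(1) by auto
  ultimately show ?thesis unfolding weights_iff by blast
qed

text \<open>The action of a coset is defined by means of a chosen representative; any representative gives the
  same functional on \<open>\<aa>\<close>, because the elements of the centraliser fix \<open>\<aa>\<close> pointwise.\<close>

lemma weyl_orbit_eq: "weyl_orbit G K \<aa> \<nu> = (\<lambda>k. coadjoint k \<nu>) ` N"
proof -
  let ?Z = "centralizer_in G K \<aa>"
  let ?coset = "\<lambda>a. ?Z #>\<^bsub>G\<lparr>carrier := N\<rparr>\<^esub> a"
  have coset: "?coset a = {z \<otimes> a | z. z \<in> ?Z}" for a
    by (auto simp: r_coset_def)
  have action: "weyl_action G \<aa> (?coset a) \<nu> = coadjoint a \<nu>" if a: "a \<in> N" for a
  proof -
    have "\<one> \<in> ?Z" using subgroup.one_closed[OF subgroup_K] by (simp add: centralizer_in_def Ad_one)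
    then have "\<exists>k. k \<in> ?coset a" unfolding coset by blast
    then have "(SOME k. k \<in> ?coset a) \<in> ?coset a" by (rule someI_ex)
    then obtain z where z: "z \<in> ?Z" "(SOME k. k \<in> ?coset a) = z \<otimes> a" unfolding coset by blast
    have zc: "z \<in> carrier G" using z(1) K_closed(1) by (simp add: centralizer_in_def)
    have ac: "a \<in> carrier G" using normalizer_props(2)[OF a] .
    have "Ad G (inv (z \<otimes> a)) H = Ad G (inv a) H" if H: "H \<in> \<aa>" for H
    proof -
      have "Ad G z H = H" using z(1) H by (simp add: centralizer_in_def)
      then have "Ad G (inv z) H = H" using Ad_inv(1)[OF zc, of H] by simp
      then show ?thesis using zc ac by (simp add: inv_mult_group Ad_mult)
    qed
    then show ?thesis unfolding weyl_action_def coadjoint_def z(2) by auto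
  qed
  have "carrier (weyl_group G K \<aa>) = ?coset ` N"
    by (auto simp: weyl_group_def FactGroup_def RCOSETS_def)
  then have "weyl_orbit G K \<aa> \<nu> = (\<lambda>a. weyl_action G \<aa> (?coset a) \<nu>) ` N"
    unfolding weyl_orbit_def by auto
  then show ?thesis using action by (simp cong: image_cong)
qed

lemma weyl_orbit_subset_weights: "\<mu> \<in> wts \<Longrightarrow> weyl_orbit G K \<aa> \<mu> \<subseteq> wts"
  using weights_invariant by (auto simp: weyl_orbit_eq)

section \<open>The convex hull of the Weyl orbit\<close>

lemma sum_fun_apply: "(\<Sum>i\<in>I. f i) x = (\<Sum>i\<in>I. f i x)"
  by (induction I rule: infinite_finite_induct) auto

lemma highest_weight_dominates:
  assumes \<mu>: "highest_weight G \<aa> C \<tau> \<mu>" and \<nu>: "\<nu> \<in> wts"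
    and H: "\<And>\<alpha>. \<alpha> \<in> positive_roots G \<aa> C \<Longrightarrow> \<alpha> H \<ge> 0"
  shows "\<nu> H \<le> \<mu> H"
proof -
  obtain c :: "('e \<Rightarrow> real) \<Rightarrow> nat"
    where c: "\<nu> = \<mu> - (\<Sum>\<alpha>\<in>simple_roots G \<aa> C. real (c \<alpha>) *\<^sub>R \<alpha>)"
    using \<mu> \<nu> unfolding highest_weight_def by blast
  have "\<nu> H = \<mu> H - (\<Sum>\<alpha>\<in>simple_roots G \<aa> C. real (c \<alpha>) * \<alpha> H)"
    by (simp add: c sum_fun_apply)
  moreover have "(\<Sum>\<alpha>\<in>simple_roots G \<aa> C. real (c \<alpha>) * \<alpha> H) \<ge> 0"
    using H by (intro sum_nonneg) (auto simp: simple_roots_def)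
  ultimately show ?thesis by simp
qed

lemma orbit_bounds_weight_at_regular:
  assumes C: "weyl_chamber G \<aa> C" and \<mu>: "highest_weight G \<aa> C \<tau> \<mu>" and \<nu>: "\<nu> \<in> wts"
    and H: "H \<in> \<aa>" "\<forall>\<alpha>\<in>roots. \<alpha> H \<noteq> 0"
  shows "\<exists>\<eta>\<in>weyl_orbit G K \<aa> \<mu>. \<nu> H \<le> \<eta> H"
proof -
  have comp: "C \<in> components {H \<in> \<aa>. \<forall>\<alpha>\<in>roots. \<alpha> H \<noteq> 0}" using C by (simp add: weyl_chamber_def)
  obtain Y where Y: "Y \<in> C" using in_components_nonempty[OF comp] by blast
  then have Ya: "Y \<in> \<aa>" "\<forall>\<alpha>\<in>roots. \<alpha> Y \<noteq> 0" using in_components_subset[OF comp] by auto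
  obtain k where k: "k \<in> N" "\<And>\<alpha>. \<alpha> \<in> roots \<Longrightarrow> \<alpha> (Ad G k H) * \<alpha> Y \<ge> 0"
    using regular_conjugate_to_chamber[OF H Ya] by blast
  note kp = normalizer_props[OF k(1)]
  have "\<alpha> (Ad G k H) \<ge> 0" if "\<alpha> \<in> positive_roots G \<aa> C" for \<alpha>
    using that k(2)[of \<alpha>] Y by (auto simp: positive_roots_def zero_le_mult_iff)
  then have "coadjoint k \<nu> (Ad G k H) \<le> \<mu> (Ad G k H)"
    by (rule highest_weight_dominates[OF \<mu> weights_invariant[OF k(1) \<nu>]])
  moreover have "coadjoint k \<nu> (Ad G k H) = \<nu> H"
    using kp(3)[OF H(1)] by (simp add: coadjoint_def Ad_inv(1)[OF kp(2)])
  moreover have "coadjoint (inv k) \<mu> H = \<mu> (Ad G k H)"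
    using H(1) kp(2) by (simp add: coadjoint_def)
  ultimately show ?thesis using kp(5) unfolding weyl_orbit_eq by force
qed

text \<open>Functionals on \<open>\<aa>\<close> are identified with vectors of \<open>\<aa>\<close> by means of an orthonormal basis, so
  that a hyperplane separating \<open>\<nu>\<close> from the finite set \<open>F\<close> is given by an element of \<open>\<aa>\<close>.\<close>

lemma separate_functional_from_finite_set:
  assumes F: "finite F" "F \<subseteq> dual_space \<aa>" and \<nu>: "\<nu> \<in> dual_space \<aa>" "\<nu> \<notin> convex hull F"
  obtains H where "H \<in> \<aa>" "\<And>\<eta>. \<eta> \<in> F \<Longrightarrow> \<eta> H < \<nu> H"
proof -
  obtain B where B: "B \<subseteq> \<aa>" "pairwise orthogonal B" "\<And>b. b \<in> B \<Longrightarrow> norm b = 1"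
    "independent B" "span B = \<aa>"
    using orthonormal_basis_subspace[OF \<aa>_props(1)] by metis
  have finB: "finite B" using B(4) by (rule independent_imp_finite)
  define R :: "('e \<Rightarrow> real) \<Rightarrow> 'e" where "R \<eta> = (\<Sum>b\<in>B. \<eta> b *\<^sub>R b)" for \<eta>
  have linR: "linear R"
    by (intro linearI) (simp_all add: R_def scaleR_add_left sum.distrib scaleR_sum_right)
  define P where "P w = (\<Sum>b\<in>B. (w \<bullet> b) *\<^sub>R b)" for w
  have eval: "\<eta> (P w) = w \<bullet> R \<eta>" if "\<eta> \<in> dual_space \<aa>" for \<eta> w
    using B(1) unfolding P_def R_def
    by (subst dual_space_sum[OF that]) (auto simp: inner_sum_right mult.commute)
  have P_id: "P x = x" if "x \<in> \<aa>" for x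
    unfolding P_def using orthonormal_basis_expand[OF B(2,3) _ finB] that B(5) by simp
  have "convex (dual_space \<aa>)"
    by (auto simp: convex_def dual_space_def algebra_simps)
  then have hull: "convex hull F \<subseteq> dual_space \<aa>" using F(2) by (intro hull_minimal)
  have "R \<nu> \<notin> R ` (convex hull F)"
  proof
    assume "R \<nu> \<in> R ` (convex hull F)"
    then obtain \<eta> where \<eta>: "\<eta> \<in> convex hull F" "R \<nu> = R \<eta>" by blast
    have "\<nu> x = \<eta> x" for x
    proof (cases "x \<in> \<aa>")
      case True
      then show ?thesis using eval[OF \<nu>(1), of x] eval[of \<eta> x] \<eta> hull by (auto simp: P_id)
    next
      case False
      then show ?thesis using dual_spaceD(3) \<nu>(1) \<eta>(1) hull by (metis subsetD)
    qed
    then have "\<nu> = \<eta>" by blast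
    then show False using \<eta>(1) \<nu>(2) by simp
  qed
  then have "R \<nu> \<notin> convex hull (R ` F)" by (simp add: convex_hull_linear_image[OF linR])
  moreover have "closed (convex hull (R ` F))"
    using F(1) by (simp add: compact_imp_closed finite_imp_compact_convex_hull)
  ultimately obtain w b where w: "w \<bullet> R \<nu> < b" "\<forall>y\<in>convex hull (R ` F). b < w \<bullet> y"
    using separating_hyperplane_closed_point[OF convex_convex_hull] by metis
  have "P (- w) \<in> \<aa>"
    unfolding P_def using B(1) \<aa>_props(1) by (intro subspace_sum subspace_scale) auto
  moreover have "\<eta> (P (- w)) < \<nu> (P (- w))" if \<eta>: "\<eta> \<in> F" for \<eta>
  proof -
    have "w \<bullet> R \<nu> < w \<bullet> R \<eta>"
      using w \<eta> hull_subset[of "R ` F" convex] by (meson image_eqI order.strict_trans subsetD)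
    then show ?thesis using eval[OF \<nu>(1)] eval[of \<eta>] \<eta> F(2) by auto
  qed
  ultimately show ?thesis using that by blast
qed

text \<open>Since there are only finitely many roots and orbit points, a separating element may be moved a
  little in the direction of the chamber to make it regular.\<close>

lemma weights_subset_convex_hull_weyl_orbit:
  assumes C: "weyl_chamber G \<aa> C" and \<mu>: "highest_weight G \<aa> C \<tau> \<mu>"
  shows "wts \<subseteq> convex hull (weyl_orbit G K \<aa> \<mu>)"
proof (rule subsetI, rule ccontr)
  fix \<nu> assume \<nu>: "\<nu> \<in> wts" "\<nu> \<notin> convex hull (weyl_orbit G K \<aa> \<mu>)"
  have "\<mu> \<in> wts" using \<mu> by (simp add: highest_weight_def)
  then have sub: "weyl_orbit G K \<aa> \<mu> \<subseteq> wts" by (rule weyl_orbit_subset_weights)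
  then have fin: "finite (weyl_orbit G K \<aa> \<mu>)" using finite_weights finite_subset by blast
  have dual: "\<eta> \<in> dual_space \<aa>" if "\<eta> \<in> wts" for \<eta> using that by (simp add: weights_iff)
  obtain H0 where H0: "H0 \<in> \<aa>" "\<And>\<eta>. \<eta> \<in> weyl_orbit G K \<aa> \<mu> \<Longrightarrow> \<eta> H0 < \<nu> H0"
    using separate_functional_from_finite_set[OF fin _ dual[OF \<nu>(1)] \<nu>(2)] sub dual by blast
  have comp: "C \<in> components {H \<in> \<aa>. \<forall>\<alpha>\<in>roots. \<alpha> H \<noteq> 0}" using C by (simp add: weyl_chamber_def)
  obtain Y where "Y \<in> C" using in_components_nonempty[OF comp] by blast
  then have Y: "Y \<in> \<aa>" "\<forall>\<alpha>\<in>roots. \<alpha> Y \<noteq> 0" using in_components_subset[OF comp] by auto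
  have eval: "\<eta> (H0 + t *\<^sub>R Y) = \<eta> H0 + t * \<eta> Y" if "\<eta> \<in> dual_space \<aa>" for \<eta> t
    using H0(1) Y(1) \<aa>_props(1) by (simp add: dual_spaceD[OF that] subspace_scale)
  have lim: "((\<lambda>t. \<eta> H0 + t * \<eta> Y) \<longlongrightarrow> \<eta> H0) (at_right (0::real))" for \<eta>
    by (auto intro!: tendsto_eq_intros)
  have "\<forall>\<^sub>F t in at_right 0. \<forall>\<alpha>\<in>roots. \<alpha> H0 + t * \<alpha> Y \<noteq> 0"
  proof (rule eventually_ball_finite[OF finite_roots], rule ballI)
    fix \<alpha> assume \<alpha>: "\<alpha> \<in> roots"
    show "\<forall>\<^sub>F t in at_right 0. \<alpha> H0 + t * \<alpha> Y \<noteq> 0"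
    proof (cases "\<alpha> H0 = 0")
      case True
      then show ?thesis
        using Y(2) \<alpha> eventually_at_right_less[of "0::real"] by (auto elim: eventually_mono)
    qed (rule tendsto_imp_eventually_ne[OF lim])
  qed
  moreover have "\<forall>\<^sub>F t in at_right 0. \<forall>\<eta>\<in>weyl_orbit G K \<aa> \<mu>. \<eta> H0 + t * \<eta> Y < \<nu> H0 + t * \<nu> Y"
  proof (rule eventually_ball_finite[OF fin], rule ballI)
    fix \<eta> assume \<eta>: "\<eta> \<in> weyl_orbit G K \<aa> \<mu>"
    have "((\<lambda>t. (\<nu> H0 + t * \<nu> Y) - (\<eta> H0 + t * \<eta> Y)) \<longlongrightarrow> \<nu> H0 - \<eta> H0) (at_right 0)"
      by (intro tendsto_diff lim)
    from order_tendstoD(1)[OF this, of 0] H0(2)[OF \<eta>]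
    show "\<forall>\<^sub>F t in at_right 0. \<eta> H0 + t * \<eta> Y < \<nu> H0 + t * \<nu> Y" by simp
  qed
  ultimately have "\<forall>\<^sub>F t in at_right (0::real). (\<forall>\<alpha>\<in>roots. \<alpha> H0 + t * \<alpha> Y \<noteq> 0) \<and>
      (\<forall>\<eta>\<in>weyl_orbit G K \<aa> \<mu>. \<eta> H0 + t * \<eta> Y < \<nu> H0 + t * \<nu> Y)"
    by (rule eventually_conj)
  then obtain t where t: "\<forall>\<alpha>\<in>roots. \<alpha> H0 + t * \<alpha> Y \<noteq> 0"
    "\<forall>\<eta>\<in>weyl_orbit G K \<aa> \<mu>. \<eta> H0 + t * \<eta> Y < \<nu> H0 + t * \<nu> Y"
    using eventually_happens'[OF trivial_limit_at_right_real] by blast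
  define H where "H = H0 + t *\<^sub>R Y"
  have "H \<in> \<aa>" using H0(1) Y(1) \<aa>_props(1) by (simp add: H_def subspace_add subspace_scale)
  moreover have "\<forall>\<alpha>\<in>roots. \<alpha> H \<noteq> 0"
    using t(1) by (simp add: H_def eval restricted_roots_def)
  ultimately obtain \<eta> where \<eta>: "\<eta> \<in> weyl_orbit G K \<aa> \<mu>" "\<nu> H \<le> \<eta> H"
    using orbit_bounds_weight_at_regular[OF C \<mu> \<nu>(1)] by blast
  then show False using t(2) sub dual \<nu>(1) by (force simp: H_def eval)
qed

end

section \<open>The statement for semisimple groups\<close>

theorem proposition68:
  fixes G :: "('g, 'e::euclidean_space) lie_group_data"
    and K :: "'g set"
    and \<pp> \<aa> C :: "'e set"
    and \<tau> :: "'g \<Rightarrow> complex^'n^'n"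
    and h :: "complex^'n \<Rightarrow> complex^'n \<Rightarrow> complex"
    and \<mu> :: "'e \<Rightarrow> real"
  assumes "semisimple_lie_group G"
    and "connected_space (topo G)"
    and "\<not> compact_space (topo G)"
    and "finite (group_center G)"
    and "maximal_compact_subgroup G K"
    and "cartan_decomposition G (lie_algebra_of_subgroup G K) \<pp>"
    and "smooth_representation G \<tau>"
    and "irreducible_rep G \<tau>"
    and "finite (kernel G SL \<tau>)"
    and "hermitian_scalar_product h"
    and "compatible_rep G K \<pp> h \<tau>"
    and "maximal_abelian_subalgebra_in G \<pp> \<aa>"
    and "weyl_chamber G \<aa> C"
    and "highest_weight G \<aa> C \<tau> \<mu>"
  shows "weights G \<aa> \<tau> \<subseteq> convex hull (weyl_orbit G K \<aa> \<mu>)"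
proof -
  obtain T :: "complex^'n^'n" where T: "invertible T"
    "\<And>x y. h (T *v x) (T *v y) = (\<Sum>i\<in>UNIV. x $ i * cnj (y $ i))"
    using hermitian_orthonormal_frame[OF assms(10)] by blast
  have G: "lie_group G" using assms(1) by (simp add: semisimple_lie_group_def)
  have K: "subgroup K G" "compactin (topo G) K"
    using assms(5) by (simp_all add: maximal_compact_subgroup_def)
  interpret compatible_representation_with_torus G \<tau> K \<pp> h T \<aa>
    by (intro compatible_representation_with_torus.intro compatible_representation.intro
        matrix_representation.intro real_lie_group.intro matrix_representation_axioms.intro
        compatible_representation_axioms.intro compatible_representation_with_torus_axioms.intro)
      (fact G K assms T)+
  show ?thesis
    using assms(13,14) by (rule weights_subset_convex_hull_weyl_orbit)
qed

end
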